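(* Let $n\ge 2$ and let $X$ be a Hermitian circulant on vertices $x_0,\dots,x_{n-1}$, i.e., its Hermitian matrix $H_X$ satisfies $(H_X)_{x_a,x_b}=c_{(b-a)\bmod n}$ for some complex numbers $c_0,\dots,c_{n-1}$. Let $F_n$ be the $n\times n$ matrix with $(F_n)_{a,j}=\frac{1}{\sqrt n}\zeta^{aj}$ ($0\le a,j\le n-1$), $\zeta=e^{2\pi i/n}$, and let $\theta_j$ be defined by $H_XF_ne_j=\theta_jF_ne_j$. Assume that $X$ admits universal perfect state transfer, that its eigenvalues have the form $\theta_j=\alpha+\beta(jk+c'_jn)$ for $j=0,\dots,n-1$, with $\alpha,\beta\in\mathbb{R}$, $\beta>0$, $c'_0,\dots,c'_{n-1}\in\mathbb{Z}$ and an integer $k$ coprime with $n$, and that $\theta_0,\dots,\theta_{n-1}\in\mathbb{Q}$. Let $\gamma$ be a transcendental real number and $m$ a positive integer. Let $Z=X\circ P_m^{\gamma}$ be the Hermitian graph with vertices $(x_a,j)$, $0\le a\le n-1$, $1\le j\le m$, whose Hermitian matrix (with $(x_a,j)$ corresponding to $e_j\otimes e_a$) is $$H_Z=(e_me_m^T)\otimes H_X+T\otimes I_n,$$ where $T$ is the $m\times m$ real symmetric tridiagonal matrix with $T_{1,1}=\gamma$, $T_{r,r+1}=T_{r+1,r}=1$ for $1\le r\le m-1$, and all other entries $0$. Then for every $h$ with $1\le h\le m$, $Z$ has multiple pretty good state transfer on the set $\{(x_0,h),(x_1,h),\dots,(x_{n-1},h)\}$.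
   Context: For a Hermitian graph with Hermitian matrix $H$, $U(t)=e^{-itH}$. Perfect state transfer from $u$ to $v$ at time $\tau$: $U(\tau)e_u=\alpha e_v$ with $|\alpha|=1$. Universal perfect state transfer: perfect state transfer between every pair of distinct vertices. Pretty good state transfer from $u$ to $v$: for every $\varepsilon>0$ there is $\tau$ with $|U(\tau)_{u,v}|\ge 1-\varepsilon$. Multiple pretty good state transfer on a set $S$: pretty good state transfer between any two distinct vertices of $S$. The graph $Z$ is the rooted product of $X$ with the path $P_m^\gamma$ on vertices $1,\dots,m$, rooted at $m$, with a loop of weight $\gamma$ at vertex $1$. *)

theory Defs
  imports Jordan_Normal_Form.Schur_Decomposition
begin

text \<open>A Hermitian graph on \<open>n\<close> vertices is given by its Hermitian matrix; its vertices are
  the indices \<open>0, \<dots>, n - 1\<close> of that matrix.\<close>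

definition hermitian_graph :: "nat \<Rightarrow> complex mat \<Rightarrow> bool" where
  "hermitian_graph n H \<longleftrightarrow> H \<in> carrier_mat n n \<and> mat_adjoint H = H"

text \<open>The exponential series of a square matrix, summed entrywise.  The lemma
  \<open>summable_mat_exp\<close> below shows that every entry converges absolutely.\<close>

definition mat_exp :: "complex mat \<Rightarrow> complex mat" where
  "mat_exp A = mat (dim_row A) (dim_row A)
     (\<lambda>(i, j). \<Sum>r. (A ^\<^sub>m r) $$ (i, j) / fact r)"

lemma summable_mat_exp:
  fixes A :: "complex mat"
  assumes A: "A \<in> carrier_mat n n" and ij: "i < n" "j < n"
  shows "summable (\<lambda>r. norm ((A ^\<^sub>m r) $$ (i, j) / fact r))"
proof -
  define M where "M = (\<Sum>p<n. \<Sum>q<n. norm (A $$ (p, q)))"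
  have M: "norm (A $$ (p, q)) \<le> M" if "p < n" "q < n" for p q
  proof -
    have "norm (A $$ (p, q)) \<le> (\<Sum>q<n. norm (A $$ (p, q)))"
      using that by (intro member_le_sum) auto
    also have "\<dots> \<le> M"
      unfolding M_def using that
      by (intro member_le_sum[of p "{..<n}" "\<lambda>p. \<Sum>q<n. norm (A $$ (p, q))"])
        (auto intro: sum_nonneg)
    finally show ?thesis .
  qed
  have M0: "M \<ge> 0" unfolding M_def by (intro sum_nonneg) auto
  have pow: "norm ((A ^\<^sub>m r) $$ (i, q)) \<le> (real n * M) ^ r" if "q < n" for r q
    using that
  proof (induction r arbitrary: q)
    case 0
    then show ?case using A ij by simp
  next
    case (Suc r)
    have Ar: "A ^\<^sub>m r \<in> carrier_mat n n" using A by simp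
    have "(A ^\<^sub>m Suc r) $$ (i, q) = (\<Sum>l<n. (A ^\<^sub>m r) $$ (i, l) * A $$ (l, q))"
      using A Ar ij Suc.prems by (simp add: scalar_prod_def lessThan_atLeast0)
    also have "norm \<dots> \<le> (\<Sum>l<n. (real n * M) ^ r * M)"
      by (intro sum_norm_le, unfold norm_mult, intro mult_mono)
        (use Suc M M0 in auto)
    also have "\<dots> = (real n * M) ^ Suc r" by simp
    finally show ?case .
  qed
  have "summable (\<lambda>r. inverse (fact r) * (real n * M) ^ r)"
    by (rule summable_exp)
  then show ?thesis
    by (rule summable_comparison_test'[where N = 0])
      (use pow[OF ij(2)] in \<open>simp add: norm_divide field_simps\<close>)
qed

definition transition_mat :: "complex mat \<Rightarrow> real \<Rightarrow> complex mat" where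
  "transition_mat H t = mat_exp ((- \<i> * complex_of_real t) \<cdot>\<^sub>m H)"

definition perfect_state_transfer :: "complex mat \<Rightarrow> nat \<Rightarrow> nat \<Rightarrow> real \<Rightarrow> bool" where
  "perfect_state_transfer H u v \<tau> \<longleftrightarrow>
     (\<exists>\<alpha>. cmod \<alpha> = 1 \<and>
        transition_mat H \<tau> *\<^sub>v unit_vec (dim_row H) u = \<alpha> \<cdot>\<^sub>v unit_vec (dim_row H) v)"

definition universal_perfect_state_transfer :: "complex mat \<Rightarrow> bool" where
  "universal_perfect_state_transfer H \<longleftrightarrow>
     (\<forall>u<dim_row H. \<forall>v<dim_row H. u \<noteq> v \<longrightarrow> (\<exists>\<tau>. perfect_state_transfer H u v \<tau>))"

definition pretty_good_state_transfer :: "complex mat \<Rightarrow> nat \<Rightarrow> nat \<Rightarrow> bool" where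
  "pretty_good_state_transfer H u v \<longleftrightarrow>
     (\<forall>\<epsilon>>0. \<exists>\<tau>. cmod (transition_mat H \<tau> $$ (u, v)) \<ge> 1 - \<epsilon>)"

definition multiple_pretty_good_state_transfer :: "complex mat \<Rightarrow> nat set \<Rightarrow> bool" where
  "multiple_pretty_good_state_transfer H S \<longleftrightarrow>
     (\<forall>u\<in>S. \<forall>v\<in>S. u \<noteq> v \<longrightarrow> pretty_good_state_transfer H u v)"

definition circulant_mat :: "nat \<Rightarrow> (nat \<Rightarrow> complex) \<Rightarrow> complex mat" where
  "circulant_mat n c = mat n n (\<lambda>(a, b). c (nat ((int b - int a) mod int n)))"

definition fourier_mat :: "nat \<Rightarrow> complex mat" where
  "fourier_mat n = mat n n
     (\<lambda>(a, j). complex_of_real (1 / sqrt (real n)) * exp (2 * of_real pi * \<i> / of_nat n) ^ (a * j))"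

text \<open>The block convention of \<open>kronecker A B\<close> is the usual one (the blocks are the scalar
  multiples \<open>A $$ (p, q) \<cdot>\<^sub>m B\<close>), so for \<open>q\<close> below the dimension \<open>n\<close> of the second factor
  the basis vector \<open>e\<^sub>p \<otimes> e\<^sub>q\<close> is the unit vector of index \<open>p * n + q\<close>.\<close>

definition kronecker :: "complex mat \<Rightarrow> complex mat \<Rightarrow> complex mat" where
  "kronecker A B = mat (dim_row A * dim_row B) (dim_col A * dim_col B)
     (\<lambda>(i, j). A $$ (i div dim_row B, j div dim_col B) * B $$ (i mod dim_row B, j mod dim_col B))"

definition outer_prod :: "complex vec \<Rightarrow> complex vec \<Rightarrow> complex mat" where
  "outer_prod u v = mat (dim_vec u) (dim_vec v) (\<lambda>(i, j). u $ i * v $ j)"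

text \<open>The path vertex \<open>r\<close>, for \<open>r\<close> from \<open>1\<close> to \<open>m\<close>, has matrix index \<open>r - 1\<close>.  In particular
  the loop sits at index \<open>0\<close> and the root \<open>m\<close> has index \<open>m - 1\<close>.\<close>

definition looped_path_mat :: "nat \<Rightarrow> real \<Rightarrow> complex mat" where
  "looped_path_mat m \<gamma> = mat m m
     (\<lambda>(i, j). if i = 0 \<and> j = 0 then complex_of_real \<gamma>
              else if j = i + 1 \<or> i = j + 1 then 1 else 0)"

definition rooted_product_path :: "nat \<Rightarrow> complex mat \<Rightarrow> nat \<Rightarrow> real \<Rightarrow> complex mat" where
  "rooted_product_path n H m \<gamma> =
     kronecker (outer_prod (unit_vec m (m - 1)) (unit_vec m (m - 1))) H
     + kronecker (looped_path_mat m \<gamma>) (1\<^sub>m n)"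

text \<open>The index of the vertex \<open>(x\<^sub>a, j)\<close> of the rooted product, with \<open>a < n\<close> and \<open>j\<close> from
  \<open>1\<close> to \<open>m\<close>; it corresponds to \<open>e\<^sub>j \<otimes> e\<^sub>a\<close>.\<close>

definition rooted_vertex :: "nat \<Rightarrow> nat \<Rightarrow> nat \<Rightarrow> nat" where
  "rooted_vertex n a j = (j - 1) * n + a"

end

theory Submission
  imports Defs "HOL-Analysis.Kronecker_Approximation_Theorem"
begin

text \<open>
  The discrete Fourier transform splits \<open>H\<^sub>Z\<close> into the matrices \<open>T + \<theta>\<^sub>j e\<^sub>m e\<^sub>m\<^sup>T\<close>.  Each has \<open>m\<close>
  simple real eigenvalues (Christoffel--Darboux), and transfer from \<open>(x\<^sub>a, h)\<close> to \<open>(x\<^sub>b, h)\<close> follows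
  once some time makes all phases \<open>exp (- i t \<lambda>)\<close> of the \<open>j\<close>-th block close to \<open>\<zeta>\<close> to the power
  \<open>(b - a) j\<close>.  By Kronecker's theorem such a time exists if the target phases respect all integer relations
  among the eigenvalues.  The characteristic polynomial of the \<open>j\<close>-th block is \<open>A - \<gamma> B\<close> with coprime
  rational \<open>A\<close> and \<open>B\<close>, so as \<open>\<gamma>\<close> is transcendental it is irreducible over \<open>\<rat>(\<gamma>)\<close>.  Taking traces of
  the multiplication maps on a finite-dimensional \<open>\<rat>(\<gamma>)\<close>-space that contains all eigenvalues replaces each
  eigenvalue by \<open>(\<gamma> + \<theta>\<^sub>j) / m\<close>; hence a relation whose coefficients in the \<open>j\<close>-th block sum to \<open>L\<^sub>j\<close>
  yields \<open>\<Sum> L\<^sub>j = 0\<close> and \<open>\<Sum> L\<^sub>j \<theta>\<^sub>j = 0\<close>, which the phases respect by the form of the \<open>\<theta>\<^sub>j\<close>.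
\<close>

unbundle no vec_syntax

section \<open>Traces in field extensions\<close>

text \<open>An extension is a field homomorphism into the large field, not a subfield. The same
  results then serve both \<open>of_rat\<close> into the reals and the embedding of the fraction
  field of \<open>rat poly\<close> by evaluation at \<gamma>.\<close>

locale field_extension = field_hom hom for hom :: "'e::field \<Rightarrow> 'k::field"
begin

sublocale vector_space "\<lambda>a x. hom a * x"
  by unfold_locales (auto simp: hom_distribs algebra_simps)

sublocale mp: map_poly_inj_idom_hom hom ..

abbreviation ev :: "'e poly \<Rightarrow> 'k \<Rightarrow> 'k" where
  "ev p x \<equiv> poly (map_poly hom p) x"

lemma ev_eq_sum: "ev p x = (\<Sum>i\<le>degree p. hom (coeff p i) * x ^ i)"
  by (simp add: poly_altdef)

lemma mult_mem_span:
  assumes "\<And>s. s \<in> S \<Longrightarrow> x * s \<in> span T" "y \<in> span S"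
  shows "x * y \<in> span T"
  using assms(2)
proof (induction rule: span_induct_alt)
  case base
  then show ?case by (simp add: span_zero)
next
  case (step c s y)
  have "x * (hom c * s + y) = hom c * (x * s) + x * y"
    by (simp add: algebra_simps)
  then show ?case using step assms(1) by (metis span_add span_scale)
qed

lemma ev_mult_mem_subspace:
  assumes S: "subspace S" and stable: "\<And>y. y \<in> S \<Longrightarrow> x * y \<in> S" and y: "y \<in> S"
  shows "ev p x * y \<in> S"
proof -
  have pow: "x ^ i * y \<in> S" for i
    by (induction i) (use y stable in \<open>auto simp: mult.assoc\<close>)
  have "ev p x * y = (\<Sum>i\<le>degree p. hom (coeff p i) * (x ^ i * y))"
    by (simp add: ev_eq_sum sum_distrib_right mult.assoc)
  also have "\<dots> \<in> S"
    using pow by (intro subspace_sum[OF S] subspace_scale[OF S])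
  finally show ?thesis .
qed

lemma degree_pos_if_root:
  assumes "monic p" "ev p x = 0"
  shows "degree p > 0"
proof (rule ccontr)
  assume "\<not> degree p > 0"
  then have "p = 1" using assms(1) by (simp add: monic_degree_0)
  then show False using assms(2) by simp
qed

lemma power_degree_eq:
  assumes "monic p" "ev p x = 0"
  shows "x ^ degree p = - (\<Sum>i<degree p. hom (coeff p i) * x ^ i)"
proof -
  have "(\<Sum>i\<le>degree p. hom (coeff p i) * x ^ i) = 0"
    using assms(2) by (simp add: ev_eq_sum)
  moreover have "{..degree p} = insert (degree p) {..<degree p}"
    by auto
  ultimately show ?thesis using assms(1) by (simp add: add_eq_0_iff2)
qed

section \<open>Spans generated by powers, the analogue of the basis of a tower of extensions\<close>

definition power_translates :: "'k \<Rightarrow> nat \<Rightarrow> 'k set \<Rightarrow> 'k set" where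
  "power_translates x d C = (\<lambda>(i, c). x ^ i * c) ` ({..<d} \<times> C)"

lemma power_translates_stable:
  assumes "monic p" "ev p x = 0" "y \<in> span (power_translates x (degree p) C)"
  shows "x * y \<in> span (power_translates x (degree p) C)"
proof (rule mult_mem_span[OF _ assms(3)])
  let ?d = "degree p" let ?T = "power_translates x ?d C"
  fix t assume "t \<in> ?T"
  then obtain i c where t: "t = x ^ i * c" "i < ?d" "c \<in> C"
    by (auto simp: power_translates_def)
  have T: "x ^ j * c \<in> span ?T" if "j < ?d" for j
    using that t by (intro span_base) (auto simp: power_translates_def)
  show "x * t \<in> span ?T"
  proof (cases "Suc i < ?d")
    case True
    then show ?thesis using T[OF True] by (simp add: t mult.assoc)
  next
    case False
    then have "Suc i = ?d" using t by simp
    then have "x * t = x ^ ?d * c" by (metis t(1) mult.assoc power_Suc)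
    also have "\<dots> = - (\<Sum>i<?d. hom (coeff p i) * (x ^ i * c))"
      unfolding power_degree_eq[OF assms(1,2)] by (simp add: sum_distrib_right mult.assoc)
    also have "\<dots> \<in> span ?T"
      by (intro span_neg span_sum span_scale) (use T t in auto)
    finally show ?thesis .
  qed
qed

text \<open>Adjoins the elements one at a time: passing from \<open>S\<close> to the translates of
  \<open>S\<close> by powers of \<open>x\<close> makes the span closed under \<open>x\<close> and,
  by commutativity, keeps it closed under the earlier elements. The span stands in for a finite
  extension containing \<open>X\<close>, with no field to construct.\<close>

lemma exists_stable_finite_span:
  assumes "finite X" "\<And>x. x \<in> X \<Longrightarrow> \<exists>p. monic p \<and> ev p x = 0"
  shows "\<exists>S. finite S \<and> 1 \<in> S \<and> (\<forall>x\<in>X. \<forall>s\<in>span S. x * s \<in> span S)"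
  using assms
proof (induction X)
  case empty
  then show ?case by (intro exI[of _ "{1}"]) auto
next
  case (insert x X)
  then obtain S where S: "finite S" "1 \<in> S" "\<And>y s. y \<in> X \<Longrightarrow> s \<in> span S \<Longrightarrow> y * s \<in> span S"
    by blast
  obtain p where p: "monic p" "ev p x = 0" using insert.prems by blast
  let ?d = "degree p"
  define T where "T = power_translates x ?d S"
  have d: "?d > 0" using degree_pos_if_root[OF p] .
  have "y * t \<in> span T" if "y \<in> X" "t \<in> T" for y t
  proof -
    obtain i s where t: "t = x ^ i * s" "i < ?d" "s \<in> S"
      using \<open>t \<in> T\<close> by (auto simp: T_def power_translates_def)
    have *: "x ^ i * s' \<in> span T" if "s' \<in> S" for s'
      using that t by (intro span_base) (auto simp: T_def power_translates_def)
    have "x ^ i * (y * s) \<in> span T"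
      by (rule mult_mem_span[OF _ S(3)[OF \<open>y \<in> X\<close> span_base[OF t(3)]]]) (rule *)
    then show ?thesis by (simp add: t mult.left_commute)
  qed
  then have "\<forall>y\<in>insert x X. \<forall>s\<in>span T. y * s \<in> span T"
    using mult_mem_span[of T _ T] power_translates_stable[OF p, of _ S] unfolding T_def by blast
  moreover have "finite T" using S by (simp add: T_def power_translates_def)
  moreover have "1 \<in> T" unfolding T_def power_translates_def
    by (rule image_eqI[of _ _ "(0, 1)"]) (use d S in auto)
  ultimately show ?case by blast
qed

section \<open>The trace of multiplication by an element on a stable space, and its independence of
  the basis\<close>

definition trace_on :: "'k set \<Rightarrow> 'k \<Rightarrow> 'e" where
  "trace_on B x = (\<Sum>b\<in>B. representation B (x * b) b)"

lemma trace_on_sum: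
  assumes B: "independent B" and st: "\<And>i b. i \<in> I \<Longrightarrow> b \<in> span B \<Longrightarrow> f i * b \<in> span B"
  shows "trace_on B (\<Sum>i\<in>I. hom (l i) * f i) = (\<Sum>i\<in>I. l i * trace_on B (f i))"
proof -
  have "representation B ((\<Sum>i\<in>I. hom (l i) * f i) * b) b = (\<Sum>i\<in>I. l i * representation B (f i * b) b)"
    if "b \<in> B" for b
  proof -
    have *: "(\<Sum>i\<in>I. hom (l i) * f i) * b = (\<Sum>i\<in>I. hom (l i) * (f i * b))"
      by (simp add: sum_distrib_right mult.assoc)
    show ?thesis unfolding *
      using B st span_base[OF that]
      by (subst representation_sum) (auto simp: representation_scale span_scale)
  qed
  then have "trace_on B (\<Sum>i\<in>I. hom (l i) * f i) = (\<Sum>b\<in>B. \<Sum>i\<in>I. l i * representation B (f i * b) b)"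
    by (simp add: trace_on_def)
  also have "\<dots> = (\<Sum>i\<in>I. l i * trace_on B (f i))"
    unfolding trace_on_def sum_distrib_left by (rule sum.swap)
  finally show ?thesis .
qed

text \<open>This is tr(PQ) = tr(QP): expanding the elements of each basis in the other one turns
  both traces into the same double sum, read in the two orders.\<close>

lemma trace_on_cong_span:
  assumes B: "independent B" "finite B" and C: "independent C" "finite C"
    and eq: "span B = span C" and st: "\<And>b. b \<in> span B \<Longrightarrow> x * b \<in> span B"
  shows "trace_on B x = trace_on C x"
proof -
  have "representation B (x * b) b = (\<Sum>c\<in>C. representation C b c * representation B (x * c) b)"
    if b: "b \<in> B" for b
  proof -
    have "b = (\<Sum>c\<in>C. hom (representation C b c) * c)"
      using sum_representation_eq[OF C(1) _ C(2) order_refl, of b] span_base[OF b] eq by simp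
    then have "x * b = x * (\<Sum>c\<in>C. hom (representation C b c) * c)" by simp
    also have "\<dots> = (\<Sum>c\<in>C. hom (representation C b c) * (x * c))"
      by (simp add: sum_distrib_left mult.left_commute)
    finally show ?thesis
      using span_base[of _ C] eq st B(1)
      by (simp only:, subst representation_sum) (auto simp: representation_scale span_scale)
  qed
  then have "trace_on B x = (\<Sum>b\<in>B. \<Sum>c\<in>C. representation C b c * representation B (x * c) b)"
    by (simp add: trace_on_def)
  also have "\<dots> = (\<Sum>c\<in>C. \<Sum>b\<in>B. representation C b c * representation B (x * c) b)"
    by (rule sum.swap)
  also have "\<dots> = (\<Sum>c\<in>C. representation C (x * c) c)"
  proof (rule sum.cong[OF refl])
    fix c assume c: "c \<in> C"
    have "x * c \<in> span B" using st span_base[OF c] eq by simp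
    then have "x * c = (\<Sum>b\<in>B. hom (representation B (x * c) b) * b)"
      using sum_representation_eq[OF B(1) _ B(2) order_refl, of "x * c"] by simp
    then have "representation C (x * c) c = representation C (\<Sum>b\<in>B. hom (representation B (x * c) b) * b) c"
      by simp
    also have "\<dots> = (\<Sum>b\<in>B. representation B (x * c) b * representation C b c)"
      using span_base[of _ B] eq C(1)
      by (subst representation_sum) (auto simp: representation_scale span_scale)
    finally show "(\<Sum>b\<in>B. representation C b c * representation B (x * c) b) = representation C (x * c) c"
      by (simp add: mult.commute)
  qed
  finally show ?thesis by (simp add: trace_on_def)
qed

text \<open>The Euclidean algorithm replaces inverting \<open>ev a x\<close>. Dividing
  \<open>p\<close> by \<open>a\<close> leaves a remainder of smaller degree that also sends
  \<open>u\<close> into \<open>S\<close>. If the remainder is zero, the quotient annihilates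
  \<open>x\<close>, so by minimality it has full degree and \<open>a\<close> is constant.\<close>

lemma mem_subspace_if_ev_mult_mem:
  assumes p: "ev p x = 0" and min: "\<And>a. a \<noteq> 0 \<Longrightarrow> degree a < degree p \<Longrightarrow> ev a x \<noteq> 0"
    and S: "subspace S" and stable: "\<And>y. y \<in> S \<Longrightarrow> x * y \<in> S"
  shows "a \<noteq> 0 \<Longrightarrow> degree a < degree p \<Longrightarrow> ev a x * u \<in> S \<Longrightarrow> u \<in> S"
proof (induction "degree a" arbitrary: a rule: less_induct)
  case less
  define q r where "q = p div a" and "r = p mod a"
  have pqr: "p = q * a + r" by (simp add: q_def r_def)
  have r: "r = 0 \<or> degree r < degree a"
    unfolding r_def using degree_mod_less[OF less.prems(1)] by blast
  have ev: "ev q x * ev a x + ev r x = 0"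
    using p unfolding pqr by (simp add: hom_distribs)
  show ?case
  proof (cases "r = 0")
    case True
    have "ev q x = 0" using ev min[OF less.prems(1,2)] True by simp
    moreover have "q \<noteq> 0" using pqr True less.prems by auto
    ultimately have "degree q \<ge> degree p" using min[of q] by force
    moreover have "degree p = degree q + degree a"
      using pqr True \<open>q \<noteq> 0\<close> less.prems by (simp add: degree_mult_eq)
    ultimately have "degree a = 0" by simp
    then obtain k where k: "a = [:k:]" by (metis degree_eq_zeroE)
    have "hom (inverse k) * (ev a x * u) \<in> S"
      using less.prems(3) by (rule subspace_scale[OF S])
    moreover have "hom (inverse k) * (ev a x * u) = u"
      using less.prems(1) by (simp add: k hom_distribs)
    ultimately show ?thesis by simp
  next
    case False
    have "ev r x * u = - (ev q x * (ev a x * u))"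
      using ev by (simp add: add_eq_0_iff algebra_simps)
    also have "\<dots> \<in> S"
      by (intro subspace_neg S ev_mult_mem_subspace stable less.prems)
    finally show ?thesis
      using less.hyps[of r] r False less.prems by auto
  qed
qed

text \<open>Vanishing coefficients are used instead of a degree bound, which could not express the
  zero polynomial for \<open>i = 0\<close>.\<close>

lemma span_powers:
  assumes "y \<in> span ((\<lambda>j. x ^ j * u) ` {..<i})"
  shows "\<exists>a. y = ev a x * u \<and> (\<forall>j\<ge>i. coeff a j = 0)"
  using assms
proof (induction rule: span_induct_alt)
  case base
  show ?case by (rule exI[of _ 0]) simp
next
  case (step k s y)
  then obtain j a where "s = x ^ j * u" "j < i" "y = ev a x * u" "\<forall>j\<ge>i. coeff a j = 0"
    by auto
  then show ?case
    by (intro exI[of _ "monom k j + a"])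
      (auto simp: hom_distribs poly_monom algebra_simps)
qed

lemma power_translates_insert:
  "power_translates x d (insert c C) = power_translates x d C \<union> (\<lambda>j. x ^ j * c) ` {..<d}"
  by (auto simp: power_translates_def)

text \<open>If \<open>x ^ i * u\<close> depended on the elements already present, a nonzero
  polynomial in \<open>x\<close> of degree at most \<open>i\<close>, hence below
  \<open>degree p\<close>, would send \<open>u\<close> into the old span, and then \<open>u\<close>
  itself would lie there.\<close>

lemma extend_by_powers:
  assumes p: "monic p" "ev p x = 0"
    and min: "\<And>a. a \<noteq> 0 \<Longrightarrow> degree a < degree p \<Longrightarrow> ev a x \<noteq> 0"
    and ind: "independent (power_translates x (degree p) C)"
    and u: "u \<notin> span (power_translates x (degree p) C)"
    and "i \<le> degree p"
  shows "independent (power_translates x (degree p) C \<union> (\<lambda>j. x ^ j * u) ` {..<i}) \<and>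
    inj_on (\<lambda>j. x ^ j * u) {..<i} \<and>
    power_translates x (degree p) C \<inter> (\<lambda>j. x ^ j * u) ` {..<i} = {}"
  using \<open>i \<le> degree p\<close>
proof (induction i)
  case 0
  then show ?case using ind by simp
next
  case (Suc i)
  let ?T = "power_translates x (degree p) C" and ?P = "(\<lambda>j. x ^ j * u) ` {..<i}"
  have "x ^ i * u \<notin> span (?T \<union> ?P)"
  proof
    assume "x ^ i * u \<in> span (?T \<union> ?P)"
    then obtain y z where yz: "x ^ i * u = y + z" "y \<in> span ?T" "z \<in> span ?P"
      unfolding span_Un by auto
    obtain a where a: "z = ev a x * u" "\<forall>j\<ge>i. coeff a j = 0"
      using span_powers[OF yz(3)] by blast
    let ?b = "monom 1 i - a"
    have "coeff ?b i = 1" using a(2) by simp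
    then have "?b \<noteq> 0" by (metis coeff_0 zero_neq_one)
    moreover have "degree ?b \<le> i" using a(2) by (intro degree_le) auto
    moreover have "ev ?b x * u = y"
      using yz(1) a(1) by (simp add: hom_distribs poly_monom algebra_simps)
    ultimately have "u \<in> span ?T"
      using mem_subspace_if_ev_mult_mem[OF p(2) min, of "span ?T" ?b u] yz(2) Suc.prems
        power_translates_stable[OF p] by auto
    then show False using u by simp
  qed
  moreover from this have "x ^ i * u \<notin> ?T \<union> ?P" by (rule contrapos_nn) (rule span_base)
  moreover have "{..<Suc i} = insert i {..<i}" by auto
  moreover have "independent (?T \<union> ?P)" "inj_on (\<lambda>j. x ^ j * u) {..<i}" "?T \<inter> ?P = {}"
    using Suc by simp_all
  ultimately show ?case
    by (auto simp: independent_insert)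
qed

text \<open>Greedy choice: a vector of \<open>U\<close> outside the current span is added together
  with all its translates. Injectivity is carried along so that the basis has exactly
  \<open>degree p * card C\<close> elements.\<close>

lemma exists_power_basis:
  assumes p: "monic p" "ev p x = 0"
    and min: "\<And>a. a \<noteq> 0 \<Longrightarrow> degree a < degree p \<Longrightarrow> ev a x \<noteq> 0"
    and W: "subspace W" "\<And>y. y \<in> W \<Longrightarrow> x * y \<in> W" and U: "finite U" "U \<subseteq> W"
  shows "\<exists>C\<subseteq>W. finite C \<and> independent (power_translates x (degree p) C) \<and>
    inj_on (\<lambda>(i, c). x ^ i * c) ({..<degree p} \<times> C) \<and>
    U \<subseteq> span (power_translates x (degree p) C)"
  using U
proof (induction U)
  case empty
  then show ?case by (intro exI[of _ "{}"]) (auto simp: power_translates_def independent_empty)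
next
  case (insert u U)
  let ?T = "power_translates x (degree p)"
  obtain C where C: "C \<subseteq> W" "finite C" "independent (?T C)"
    "inj_on (\<lambda>(i, c). x ^ i * c) ({..<degree p} \<times> C)" "U \<subseteq> span (?T C)"
    using insert by auto
  show ?case
  proof (cases "u \<in> span (?T C)")
    case True
    then show ?thesis using C by blast
  next
    case False
    have d: "degree p > 0" using degree_pos_if_root[OF p] .
    have ext: "independent (?T (insert u C))" "inj_on (\<lambda>j. x ^ j * u) {..<degree p}"
      "?T C \<inter> (\<lambda>j. x ^ j * u) ` {..<degree p} = {}"
      using extend_by_powers[OF p min C(3) False order_refl]
      by (simp_all add: power_translates_insert)
    have "inj_on (\<lambda>(i, c). x ^ i * c) ({..<degree p} \<times> insert u C)"
    proof -
      have *: "{..<degree p} \<times> insert u C = {..<degree p} \<times> C \<union> {..<degree p} \<times> {u}" by auto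
      have "inj_on (\<lambda>(i, c). x ^ i * c) ({..<degree p} \<times> {u})"
        using ext(2) by (auto simp: inj_on_def)
      moreover have "(\<lambda>(i, c). x ^ i * c) ` ({..<degree p} \<times> C) \<inter> (\<lambda>(i, c). x ^ i * c) ` ({..<degree p} \<times> {u}) = {}"
        using ext(3) unfolding power_translates_def by fastforce
      ultimately show ?thesis unfolding * inj_on_Un using C(4) by blast
    qed
    moreover have "span (?T C) \<subseteq> span (?T (insert u C))"
      by (intro span_mono) (auto simp: power_translates_insert)
    moreover have "u \<in> span (?T (insert u C))"
      by (rule span_base) (use d in \<open>auto simp: power_translates_def intro!: image_eqI[of _ _ "(0, u)"]\<close>)
    ultimately show ?thesis using C ext insert.prems
      by (intro exI[of _ "insert u C"]) auto
  qed
qed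

text \<open>In a basis of translates \<open>c, x c, \<dots>, x^(d-1) c\<close> multiplication by \<open>x\<close> is a block companion matrix.\<close>

lemma trace_on_power_basis:
  assumes p: "monic p" "ev p x = 0"
    and C: "finite C" "independent (power_translates x (degree p) C)"
      "inj_on (\<lambda>(i, c). x ^ i * c) ({..<degree p} \<times> C)"
  shows "trace_on (power_translates x (degree p) C) x = - of_nat (card C) * coeff p (degree p - 1)"
proof -
  let ?d = "degree p" let ?T = "power_translates x ?d C"
  have d: "?d > 0" using degree_pos_if_root[OF p] .
  have rep: "representation ?T (x * (x ^ i * c)) (x ^ i * c) =
      (if i = ?d - 1 then - coeff p (?d - 1) else 0)" if "i < ?d" "c \<in> C" for i c
  proof (cases "i = ?d - 1")
    case False
    then have "Suc i < ?d" using that by simp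
    then have "x ^ Suc i * c \<in> ?T"
      unfolding power_translates_def using that by (intro image_eqI[of _ _ "(Suc i, c)"]) auto
    moreover have "x ^ Suc i * c \<noteq> x ^ i * c"
    proof
      assume "x ^ Suc i * c = x ^ i * c"
      then have "(Suc i, c) = (i, c)"
        using C(3) that \<open>Suc i < ?d\<close> by (intro inj_onD[OF C(3)]) auto
      then show False by simp
    qed
    ultimately show ?thesis
      using representation_basis[OF C(2), of "x ^ Suc i * c"] False by (simp add: mult.assoc)
  next
    case True
    have in_T: "x ^ j * c \<in> ?T" if "j < ?d" for j
      using that \<open>c \<in> C\<close> by (auto simp: power_translates_def)
    have "Suc i = ?d" using True d by simp
    then have "x * (x ^ i * c) = x ^ ?d * c" by (metis mult.assoc power_Suc)
    also have "\<dots> = (\<Sum>j<?d. hom (- coeff p j) * (x ^ j * c))"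
      unfolding power_degree_eq[OF p]
      by (simp add: sum_distrib_right mult.assoc sum_negf hom_distribs)
    finally have eq: "x * (x ^ i * c) = (\<Sum>j<?d. hom (- coeff p j) * (x ^ j * c))" .
    have "representation ?T (x * (x ^ i * c)) (x ^ i * c) =
        (\<Sum>j<?d. representation ?T (hom (- coeff p j) * (x ^ j * c)) (x ^ i * c))"
      unfolding eq by (subst representation_sum[OF C(2)]) (use in_T span_base span_scale in blast)+
    also have "\<dots> = (\<Sum>j<?d. - coeff p j * representation ?T (x ^ j * c) (x ^ i * c))"
      using in_T by (intro sum.cong refl) (subst representation_scale[OF C(2)], auto intro: span_base)
    also have "\<dots> = (\<Sum>j<?d. if j = i then - coeff p j else 0)"
    proof (rule sum.cong[OF refl])
      fix j assume j: "j \<in> {..<?d}"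
      have "x ^ j * c = x ^ i * c \<longleftrightarrow> j = i"
        using inj_onD[OF C(3), of "(j, c)" "(i, c)"] j that by auto
      then show "- coeff p j * representation ?T (x ^ j * c) (x ^ i * c) = (if j = i then - coeff p j else 0)"
        using representation_basis[OF C(2) in_T[of j]] j by auto
    qed
    also have "\<dots> = - coeff p (?d - 1)" using that True by simp
    finally show ?thesis using True by simp
  qed
  have "trace_on ?T x = (\<Sum>(i, c)\<in>{..<?d} \<times> C. representation ?T (x * (x ^ i * c)) (x ^ i * c))"
    using sum.reindex[OF C(3), of "\<lambda>b. representation ?T (x * b) b"]
    by (simp add: trace_on_def power_translates_def o_def case_prod_unfold)
  also have "\<dots> = (\<Sum>(i, c)\<in>{..<?d} \<times> C. if i = ?d - 1 then - coeff p (?d - 1) else 0)"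
    using rep by (intro sum.cong) auto
  also have "\<dots> = (\<Sum>i<?d. \<Sum>c\<in>C. if i = ?d - 1 then - coeff p (?d - 1) else 0)"
    by (rule sum.cartesian_product[symmetric])
  also have "\<dots> = (\<Sum>i<?d. if i = ?d - 1 then - of_nat (card C) * coeff p (?d - 1) else 0)"
    by (intro sum.cong) auto
  also have "\<dots> = - of_nat (card C) * coeff p (?d - 1)" using d by simp
  finally show ?thesis .
qed

text \<open>On one nonzero finite-dimensional space stable under all \<open>f i\<close>, the trace
  of \<open>f i\<close> is \<open>- coeff (p i) (d - 1)\<close> times dimension over
  \<open>d\<close>. This factor is the same for every \<open>i\<close> because the degrees agree, so
  taking the trace of the relation and cancelling the dimension gives the claim.\<close>

theorem sum_trace_coeff_eq_0:
  fixes f :: "'i \<Rightarrow> 'k"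
  assumes "finite I" and char_0: "\<And>n. n > 0 \<Longrightarrow> of_nat n \<noteq> (0 :: 'e)"
    and p: "\<And>i. i \<in> I \<Longrightarrow> monic (p i)" "\<And>i. i \<in> I \<Longrightarrow> degree (p i) = d" "\<And>i. i \<in> I \<Longrightarrow> ev (p i) (f i) = 0"
    and min: "\<And>i a. i \<in> I \<Longrightarrow> a \<noteq> 0 \<Longrightarrow> degree a < d \<Longrightarrow> ev a (f i) \<noteq> 0"
    and rel: "(\<Sum>i\<in>I. hom (l i) * f i) = 0"
  shows "(\<Sum>i\<in>I. l i * coeff (p i) (d - 1)) = 0"
proof -
  obtain S where S: "finite S" "1 \<in> S" "\<And>i s. i \<in> I \<Longrightarrow> s \<in> span S \<Longrightarrow> f i * s \<in> span S"
    using exists_stable_finite_span[of "f ` I"] assms(1) p(1,3) by blast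
  obtain B where B: "B \<subseteq> S" "independent B" "S \<subseteq> span B"
    using maximal_independent_subset[of S] by blast
  have "span B = span S"
    using span_mono[OF B(1)] span_minimal[OF B(3) subspace_span] by blast
  note B = B(1,2) this
  have finB: "finite B" using B S finite_subset by blast
  have "B \<noteq> {}"
  proof
    assume "B = {}"
    then have "span S = {0}" using B(3) by simp
    then show False using span_base[OF S(2)] by simp
  qed
  then have card: "card B > 0" using finB by (simp add: card_gt_0_iff)
  \<comment> \<open>Multiplying by \<open>d\<close> puts \<open>card B\<close> in place of
    \<open>d * card C\<close>, so the right-hand factor no longer mentions the set \<open>C\<close>
    chosen for this \<open>i\<close>.\<close>
  have tr: "of_nat d * trace_on B (f i) = - of_nat (card B) * coeff (p i) (d - 1)" if i: "i \<in> I" for i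
  proof -
    have min': "a \<noteq> 0 \<Longrightarrow> degree a < degree (p i) \<Longrightarrow> ev a (f i) \<noteq> 0" for a
      using min i p by metis
    have st: "\<And>y. y \<in> span B \<Longrightarrow> f i * y \<in> span B" using S(3)[OF i] B by simp
    obtain C where C: "C \<subseteq> span B" "finite C" "independent (power_translates (f i) d C)"
      "inj_on (\<lambda>(j, c). f i ^ j * c) ({..<d} \<times> C)" "B \<subseteq> span (power_translates (f i) d C)"
      using exists_power_basis[OF p(1,3)[OF i] min' subspace_span st finB span_superset]
      unfolding p(2)[OF i] by auto
    let ?T = "power_translates (f i) d C"
    have fin: "finite ?T" using C(2) by (simp add: power_translates_def)
    have "f i ^ j * c \<in> span B" if "c \<in> span B" for j c
      by (induction j) (use that st in \<open>auto simp: mult.assoc\<close>)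
    then have "?T \<subseteq> span B" using C(1) by (auto simp: power_translates_def)
    then have eq: "span B = span ?T" using C(5) by (simp add: span_eq)
    have "card B = dim (span B)" using dim_span_eq_card_independent[OF B(2)] by simp
    also have "\<dots> = card ?T" unfolding eq by (rule dim_span_eq_card_independent[OF C(3)])
    also have "\<dots> = d * card C"
      unfolding power_translates_def by (subst card_image[OF C(4)]) (simp add: card_cartesian_product)
    finally have cardB: "card B = d * card C" .
    have "trace_on B (f i) = - of_nat (card C) * coeff (p i) (d - 1)"
      using trace_on_cong_span[OF B(2) finB C(3) fin eq st]
        trace_on_power_basis[OF p(1,3)[OF i] C(2)] C(3,4) p(2)[OF i] by simp
    then show ?thesis by (simp add: cardB)
  qed
  have "(\<Sum>i\<in>I. l i * trace_on B (f i)) = trace_on B 0"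
    using trace_on_sum[OF B(2), of I f l] S(3) B(3) rel by simp
  also have "\<dots> = 0" by (simp add: trace_on_def representation_zero)
  finally have "0 = of_nat d * (\<Sum>i\<in>I. l i * trace_on B (f i))" by simp
  also have "\<dots> = (\<Sum>i\<in>I. l i * (of_nat d * trace_on B (f i)))"
    by (simp add: sum_distrib_left mult.left_commute)
  also have "\<dots> = - of_nat (card B) * (\<Sum>i\<in>I. l i * coeff (p i) (d - 1))"
    using tr by (simp add: sum_distrib_left sum_negf mult.left_commute)
  finally show ?thesis using char_0[OF card] by simp
qed

end

section \<open>Eigenvalues of the looped path\<close>

context field_extension
begin

text \<open>These are \<open>card S + 1\<close> elements of a span of \<open>card S\<close> vectors,
  so two coincide or they are dependent; either way a nonzero polynomial in \<open>y\<close> kills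
  \<open>z\<close>. The factor \<open>z\<close> leaves room for a denominator of
  \<open>y\<close>.\<close>

lemma algebraic_if_powers_in_span:
  assumes S: "finite S" and z: "z \<noteq> 0" and mem: "\<And>i. i \<le> card S \<Longrightarrow> y ^ i * z \<in> span S"
  shows "\<exists>p. p \<noteq> 0 \<and> ev p y = 0"
proof (cases "inj_on (\<lambda>i. y ^ i * z) {..card S}")
  case False
  then obtain i j where ij: "i \<noteq> j" "y ^ i * z = y ^ j * z"
    by (auto simp: inj_on_def)
  then have "ev (monom 1 i - monom 1 j) y = 0"
    using z by (simp add: hom_distribs poly_monom)
  moreover have "coeff (monom 1 i - monom 1 j :: 'e poly) i = 1" using ij by simp
  then have "monom 1 i - monom 1 j \<noteq> (0 :: 'e poly)" by (metis coeff_0 zero_neq_one)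
  ultimately show ?thesis by blast
next
  case True
  let ?v = "\<lambda>i. y ^ i * z"
  have "dependent (?v ` {..card S})"
  proof (rule ccontr)
    assume "independent (?v ` {..card S})"
    then have "card (?v ` {..card S}) \<le> card S"
      using independent_span_bound[OF S, of "?v ` {..card S}"] mem by auto
    then show False using card_image[OF True] by simp
  qed
  then obtain u where u: "\<exists>v\<in>?v ` {..card S}. u v \<noteq> 0" "(\<Sum>v\<in>?v ` {..card S}. hom (u v) * v) = 0"
    by (auto simp: dependent_finite)
  define p where "p = (\<Sum>i\<le>card S. monom (u (?v i)) i)"
  have coeff: "coeff p i = u (?v i)" if "i \<le> card S" for i
    using that by (simp add: p_def coeff_sum)
  then have "p \<noteq> 0" using u(1) by force
  moreover have "ev p y * z = (\<Sum>i\<le>card S. hom (u (?v i)) * ?v i)"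
    by (simp add: p_def hom_distribs poly_sum poly_monom sum_distrib_right mult.assoc)
  then have "ev p y * z = 0"
    using u(2) sum.reindex[OF True, of "\<lambda>v. hom (u v) * v"] by simp
  ultimately show ?thesis using z by auto
qed

end

lemma real_algebraic_iff: "algebraic (x :: real) \<longleftrightarrow> (\<exists>p. p \<noteq> 0 \<and> poly (map_poly of_rat p) x = 0)"
proof
  assume "algebraic x"
  then obtain p where p: "p \<noteq> 0" "poly (of_int_poly p) x = 0" by (rule algebraicE')
  have "map_poly of_rat (of_int_poly p :: rat poly) = (of_int_poly p :: real poly)"
    by (simp add: map_poly_map_poly o_def)
  then show "\<exists>p. p \<noteq> 0 \<and> poly (map_poly of_rat p) x = 0"
    using p by (intro exI[of _ "of_int_poly p"]) auto
next
  assume "\<exists>p. p \<noteq> 0 \<and> poly (map_poly of_rat p) x = 0"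
  then obtain p :: "rat poly" where "p \<noteq> 0" "poly (map_poly of_rat p) x = 0" by blast
  then show "algebraic x"
    unfolding algebraic_altdef by (intro exI[of _ "map_poly of_rat p"]) auto
qed

interpretation rat_ext: field_extension "of_rat :: rat \<Rightarrow> real" ..

text \<open>Multiplied by a large enough power of the denominator, the powers of the quotient
  \<open>y\<close> become polynomials in \<open>x\<close>, which all lie in one finite-dimensional
  space. With \<open>y\<close> = \<gamma> this forces every eigenvalue to be transcendental.\<close>

lemma algebraic_if_mult_eq:
  fixes x y :: real
  assumes x: "algebraic x" and eq: "y * poly (map_poly of_rat b) x = poly (map_poly of_rat a) x"
    and b: "poly (map_poly of_rat b) x \<noteq> 0"
  shows "algebraic y"
proof -
  obtain f :: "rat poly" where f: "f \<noteq> 0" "rat_ext.ev f x = 0"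
    using x by (auto simp: real_algebraic_iff)
  let ?g = "smult (inverse (lead_coeff f)) f"
  have "monic ?g" "rat_ext.ev ?g x = 0" using f by (auto simp: hom_distribs)
  then have "\<exists>p. monic p \<and> rat_ext.ev p x = 0" by blast
  then obtain S where S: "finite S" "1 \<in> S" "\<And>s. s \<in> rat_ext.span S \<Longrightarrow> x * s \<in> rat_ext.span S"
    using rat_ext.exists_stable_finite_span[of "{x}"] by auto
  have st: "rat_ext.ev p x * s \<in> rat_ext.span S" if "s \<in> rat_ext.span S" for p s
    by (rule rat_ext.ev_mult_mem_subspace) (use S that in auto)
  define A B where "A = rat_ext.ev a x" and "B = rat_ext.ev b x"
  have mem: "y ^ i * B ^ (i + k) \<in> rat_ext.span S" for i k
  proof -
    have "A ^ i * (B ^ k * 1) \<in> rat_ext.span S"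
    proof (induction i)
      case 0
      show ?case by (induction k) (use st S rat_ext.span_base in \<open>auto simp: mult.assoc B_def\<close>)
    next
      case (Suc i)
      then show ?case using st[of _ a] by (simp add: A_def mult.assoc)
    qed
    moreover have "A ^ i * B ^ k = y ^ i * B ^ (i + k)"
      using eq by (simp add: A_def[symmetric] B_def[symmetric] power_add flip: power_mult_distrib)
    ultimately show ?thesis by simp
  qed
  have "y ^ i * B ^ card S \<in> rat_ext.span S" if "i \<le> card S" for i
    using mem[of i "card S - i"] that by simp
  then have "\<exists>p. p \<noteq> 0 \<and> rat_ext.ev p y = 0"
    using b S(1) by (intro rat_ext.algebraic_if_powers_in_span[of S "B ^ card S"]) (auto simp: B_def)
  then show ?thesis by (auto simp: real_algebraic_iff)
qed

section \<open>Extending an injective homomorphism to the fraction field\<close>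

definition fract_lift :: "('a::idom \<Rightarrow> 'k::field) \<Rightarrow> 'a fract \<Rightarrow> 'k" where
  "fract_lift h q = (THE r. \<exists>a b. b \<noteq> 0 \<and> q = Fract a b \<and> r = h a / h b)"

text \<open>\<open>h\<close> carries cross-multiplied equality of two representatives over, and
  injectivity keeps the denominators nonzero, so the description in \<open>fract_lift\<close> is
  unique.\<close>

lemma fract_lift_Fract:
  fixes h :: "'a::idom \<Rightarrow> 'k::field"
  assumes "inj_idom_hom h" "b \<noteq> 0"
  shows "fract_lift h (Fract a b) = h a / h b"
proof -
  interpret inj_idom_hom h by fact
  show ?thesis unfolding fract_lift_def
  proof (rule the_equality)
    fix r assume "\<exists>c d. d \<noteq> 0 \<and> Fract a b = Fract c d \<and> r = h c / h d"
    then obtain c d where cd: "d \<noteq> 0" "Fract a b = Fract c d" "r = h c / h d" by blast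
    then have "a * d = c * b" using assms by (simp add: eq_fract)
    then have "h a * h d = h c * h b" by (metis hom_mult)
    moreover have "h b \<noteq> 0" "h d \<noteq> 0" using assms(2) cd(1) by simp_all
    ultimately show "r = h a / h b" unfolding cd(3) by (simp add: frac_eq_eq)
  qed (use assms in blast)
qed

lemma field_hom_fract_lift:
  fixes h :: "'a::idom \<Rightarrow> 'k::field"
  assumes "inj_idom_hom h"
  shows "field_hom (fract_lift h)"
proof -
  interpret inj_idom_hom h by fact
  note [simp] = fract_lift_Fract[OF assms]
  show ?thesis
  proof
    show "fract_lift h 0 = 0" by (simp add: Zero_fract_def)
    show "fract_lift h 1 = 1" by (simp add: One_fract_def)
    fix x y :: "'a fract"
    show "fract_lift h (x + y) = fract_lift h x + fract_lift h y"
      by (cases x; cases y) (simp add: hom_distribs add_frac_eq)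
    show "fract_lift h (x * y) = fract_lift h x * fract_lift h y"
      by (cases x; cases y) (simp add: hom_distribs)
  qed
qed

lemma clear_denominators:
  fixes a :: "'a::idom fract poly"
  shows "\<exists>d n. d \<noteq> 0 \<and> map_poly (\<lambda>c. Fract c 1) n = smult (Fract d 1) a"
proof (induction a)
  case 0
  show ?case by (rule exI[of _ 1], rule exI[of _ 0]) simp
next
  case (pCons c a)
  then obtain d n where dn: "d \<noteq> 0" "map_poly (\<lambda>c. Fract c 1) n = smult (Fract d 1) a" by blast
  obtain u v where uv: "c = Fract u v" "v \<noteq> 0" by (cases c)
  have co: "Fract (coeff n i) 1 = Fract d 1 * coeff a i" for i
    using arg_cong[OF dn(2), of "\<lambda>p. coeff p i"] by (simp add: coeff_map_poly Zero_fract_def)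
  \<comment> \<open>With \<open>c\<close> = u/v the new common denominator is \<open>d * v\<close>:
    the old numerators are scaled by \<open>v\<close> and the new one by \<open>d\<close>.\<close>
  have "map_poly (\<lambda>c. Fract c 1) (pCons (u * d) (smult v n)) = smult (Fract (d * v) 1) (pCons c a)"
  proof (rule poly_eqI)
    fix i
    have "Fract (v * coeff n j) 1 = Fract (d * v) 1 * coeff a j" for j
    proof -
      have "Fract (v * coeff n j) 1 = Fract v 1 * Fract (coeff n j) 1" by simp
      also have "\<dots> = Fract (d * v) 1 * coeff a j"
        unfolding co by (simp add: mult.assoc[symmetric] mult.commute)
      finally show ?thesis .
    qed
    moreover have "Fract (u * d) 1 = Fract (d * v) 1 * c"
      using uv by (simp add: eq_fract)
    ultimately show "coeff (map_poly (\<lambda>c. Fract c 1) (pCons (u * d) (smult v n))) i =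
        coeff (smult (Fract (d * v) 1) (pCons c a)) i"
      by (cases i) (simp_all add: coeff_map_poly Zero_fract_def)
  qed
  then show ?case using dn(1) uv(2) by (metis mult_eq_0_iff)
qed


text \<open>\<open>path_poly g s\<close> is the characteristic polynomial of the first \<open>s\<close> vertices of the path, and its value
  at an eigenvalue is the entry of the eigenvector at matrix index \<open>s\<close>.\<close>

fun path_poly :: "'a::comm_ring_1 \<Rightarrow> nat \<Rightarrow> 'a poly" where
  "path_poly g 0 = 1"
| "path_poly g (Suc 0) = [:- g, 1:]"
| "path_poly g (Suc (Suc s)) = [:0, 1:] * path_poly g (Suc s) - path_poly g s"

text \<open>The claims are proved together because the degree bound removes the contribution of
  \<open>path_poly g s\<close> from the two top coefficients. The coefficient below the top is minus
  the trace of the path matrix, whose only diagonal entry is the loop.\<close>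

lemma degree_coeff_path_poly:
  "degree (path_poly g s) \<le> s \<and> coeff (path_poly g s) s = 1 \<and>
    (s > 0 \<longrightarrow> coeff (path_poly g s) (s - 1) = - (g :: 'a :: comm_ring_1))"
proof (induction g s rule: path_poly.induct)
  case (3 g s)
  have "degree (path_poly g (Suc (Suc s))) \<le> Suc (Suc s)"
    using 3 by (auto intro!: degree_diff_le degree_pCons_le[THEN order_trans])
  moreover have "coeff (path_poly g s) (Suc (Suc s)) = 0" "coeff (path_poly g s) (Suc s) = 0"
    using 3 by (auto intro!: coeff_eq_0)
  ultimately show ?case using 3 by simp
qed auto

lemma degree_path_poly [simp]: "degree (path_poly g s) = s"
  using degree_coeff_path_poly[of g s] by (metis le_antisym le_degree zero_neq_one)

lemma coeff_path_poly_self [simp]: "coeff (path_poly g s) s = 1"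
  and coeff_path_poly_pred: "s > 0 \<Longrightarrow> coeff (path_poly g s) (s - 1) = - g"
  using degree_coeff_path_poly[of g s] by auto

text \<open>Expansion of the determinant along the loop: deleting the looped vertex leaves a path
  without loop.\<close>

lemma path_poly_Suc_eq:
  "path_poly g (Suc s) = path_poly 0 (Suc s) - smult g (path_poly 0 s)"
proof (induction g s rule: path_poly.induct)
  case (3 g s)
  have "path_poly g (Suc (Suc (Suc s))) = [:0, 1:] * path_poly g (Suc (Suc s)) - path_poly g (Suc s)"
    by simp
  also have "\<dots> = path_poly 0 (Suc (Suc (Suc s))) - smult g (path_poly 0 (Suc (Suc s)))"
    unfolding 3 by (simp add: algebra_simps smult_diff_right)
  finally show ?case .
qed (simp_all add: algebra_simps)

lemma (in comm_ring_hom) map_poly_path_poly: "map_poly hom (path_poly g s) = path_poly (hom g) s"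
proof (induction g s rule: path_poly.induct)
  case (3 g s)
  interpret mp: map_poly_comm_ring_hom hom ..
  from 3 show ?case by (simp add: hom_distribs)
qed (auto simp: hom_distribs)

text \<open>The characteristic polynomial of the path with the loop \<open>g\<close> at its first
  vertex and a further loop \<theta> at its last one, hence of T + \<theta> e_m e_m^T. For
  \<open>m = 1\<close> both loops sit on the same vertex.\<close>

definition looped_path_poly :: "'a::comm_ring_1 \<Rightarrow> 'a \<Rightarrow> nat \<Rightarrow> 'a poly" where
  "looped_path_poly g \<theta> m = path_poly g m - smult \<theta> (path_poly g (m - 1))"

lemma degree_looped_path_poly [simp]:
  assumes "m > 0"
  shows "degree (looped_path_poly g \<theta> m) = m"
proof -
  have "degree (smult \<theta> (path_poly g (m - 1))) < m"
    using degree_smult_le[of \<theta> "path_poly g (m - 1)"] assms by simp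
  then show ?thesis unfolding looped_path_poly_def diff_conv_add_uminus
    by (subst degree_add_eq_left) simp_all
qed

lemma coeff_looped_path_poly:
  assumes "m > 0"
  shows "coeff (looped_path_poly g \<theta> m) m = 1" "coeff (looped_path_poly g \<theta> m) (m - 1) = - (g + \<theta>)"
proof -
  have "coeff (path_poly g (m - 1)) m = 0" using assms by (intro coeff_eq_0) simp
  then show "coeff (looped_path_poly g \<theta> m) m = 1"
    by (simp add: looped_path_poly_def)
  show "coeff (looped_path_poly g \<theta> m) (m - 1) = - (g + \<theta>)"
    using assms by (simp add: looped_path_poly_def coeff_path_poly_pred[OF assms, unfolded One_nat_def])
qed

lemma monic_looped_path_poly: "m > 0 \<Longrightarrow> monic (looped_path_poly g \<theta> m)"
  by (simp add: coeff_looped_path_poly)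

lemma (in comm_ring_hom) map_poly_looped_path_poly:
  "map_poly hom (looped_path_poly g \<theta> m) = looped_path_poly (hom g) (hom \<theta>) m"
proof -
  interpret mp: map_poly_comm_ring_hom hom ..
  show ?thesis by (simp add: looped_path_poly_def hom_distribs map_poly_path_poly)
qed

text \<open>The characteristic polynomial of the path with the vertex carrying the loop \<open>g\<close> removed.\<close>

definition trimmed_path_poly :: "'a::comm_ring_1 \<Rightarrow> nat \<Rightarrow> 'a poly" where
  "trimmed_path_poly \<theta> m =
    (if m = 1 then 1 else path_poly 0 (m - 1) - smult \<theta> (path_poly 0 (m - 2)))"

lemma (in comm_ring_hom) map_poly_trimmed_path_poly:
  "map_poly hom (trimmed_path_poly \<theta> m) = trimmed_path_poly (hom \<theta>) m"
proof -
  interpret mp: map_poly_comm_ring_hom hom ..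
  show ?thesis by (simp add: trimmed_path_poly_def hom_distribs map_poly_path_poly)
qed

text \<open>The loop weight occurs in a single matrix entry, so the polynomial is affine in
  \<open>g\<close>. At a root this expresses \<open>g\<close> as a quotient of two polynomials that
  do not involve \<open>g\<close>.\<close>

lemma looped_path_poly_linear:
  assumes "m > 0"
  shows "looped_path_poly g \<theta> m = looped_path_poly 0 \<theta> m - smult g (trimmed_path_poly \<theta> m)"
proof -
  consider "m = 1" | r where "m = Suc (Suc r)"
    using assms by (cases m rule: nat.exhaust; cases "m - 1") auto
  then show ?thesis
  proof cases
    case 1
    then show ?thesis by (simp add: looped_path_poly_def trimmed_path_poly_def)
  next
    case 2
    have "m - 1 = Suc r" "m - 2 = r" "m \<noteq> 1" using 2 by simp_all
    then show ?thesis
      unfolding looped_path_poly_def trimmed_path_poly_def \<open>m = _\<close> diff_Suc_1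
        path_poly_Suc_eq[of g "Suc r"] path_poly_Suc_eq[of g r]
      by (simp add: algebra_simps smult_diff_right del: path_poly.simps)
  qed
qed

text \<open>The Casorati determinant of the three-term recurrence is constant because one step of
  the recurrence has determinant 1.\<close>

lemma path_poly_casorati:
  "path_poly 0 (Suc (Suc r)) * path_poly 0 r - path_poly 0 (Suc r) ^ 2 = (- 1 :: 'a::comm_ring_1 poly)"
proof (induction r)
  case 0
  show ?case by (simp add: power2_eq_square)
next
  case (Suc r)
  have *: "path_poly 0 (Suc (Suc (Suc r))) = [:0, 1:] * path_poly 0 (Suc (Suc r)) - (path_poly 0 (Suc r) :: 'a poly)"
    "path_poly 0 r = [:0, 1:] * path_poly 0 (Suc r) - (path_poly 0 (Suc (Suc r)) :: 'a poly)"
    by simp_all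
  show ?case
    unfolding * using Suc.IH unfolding *(2)
    by (simp add: algebra_simps power2_eq_square del: path_poly.simps)
qed

text \<open>The cofactors are chosen so that the terms with \<theta> cancel and only the Casorati
  determinant remains. An explicit identity can also be evaluated at a root.\<close>

lemma looped_trimmed_bezout:
  assumes "m > 0"
  shows "\<exists>C D. looped_path_poly 0 \<theta> m * C + trimmed_path_poly \<theta> m * D = (1 :: 'a::comm_ring_1 poly)"
proof -
  consider "m = 1" | r where "m = Suc (Suc r)"
    using assms by (cases m rule: nat.exhaust; cases "m - 1") auto
  then show ?thesis
  proof cases
    case 1
    then show ?thesis by (intro exI[of _ 0] exI[of _ 1]) (simp add: trimmed_path_poly_def)
  next
    case 2
    let ?U = "path_poly (0 :: 'a)"
    have "looped_path_poly 0 \<theta> m * - ?U r + trimmed_path_poly \<theta> m * ?U (Suc r) =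
        - (?U (Suc (Suc r)) * ?U r - ?U (Suc r) ^ 2)"
      using 2 by (simp add: looped_path_poly_def trimmed_path_poly_def algebra_simps
          power2_eq_square del: path_poly.simps)
    also have "\<dots> = 1" unfolding path_poly_casorati by simp
    finally show ?thesis by blast
  qed
qed

section \<open>Identities homogeneous in two coprime polynomials\<close>

lemma dvd_mult_power_bezoutD:
  fixes a b :: "'a::comm_ring_1"
  assumes "a * c + b * d = 1" "a dvd x * b ^ n"
  shows "a dvd x"
  using assms(2)
proof (induction n)
  case (Suc n)
  have "x * b ^ n = x * b ^ n * (a * c + b * d)" using assms(1) by simp
  also have "\<dots> = a * (c * x * b ^ n) + x * b ^ Suc n * d" by (simp add: algebra_simps)
  finally have "x * b ^ n = a * (c * x * b ^ n) + x * b ^ Suc n * d" .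
  moreover have "a dvd a * (c * x * b ^ n) + x * b ^ Suc n * d"
    by (intro dvd_add dvd_triv_left dvd_mult2[OF Suc.prems])
  ultimately have "a dvd x * b ^ n" by simp
  then show ?case by (rule Suc.IH)
qed simp

text \<open>Uniqueness of an A-adic expansion: modulo \<open>A\<close> only the term with
  \<open>k = 0\<close> survives, so \<open>A\<close> divides \<open>c 0\<close> by coprimality and
  the degree bound makes \<open>c 0\<close> vanish. Cancelling one factor \<open>A\<close> repeats
  the argument.\<close>

lemma homogeneous_combination_eq_0:
  fixes A B :: "'a::field poly"
  assumes cop: "A * C + B * D = 1" and A: "A \<noteq> 0"
    and deg: "\<And>k. k \<le> N \<Longrightarrow> c k = 0 \<or> degree (c k) < degree A"
    and sum: "(\<Sum>k\<le>N. c k * A ^ k * B ^ (N - k)) = 0"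
  shows "\<forall>k\<le>N. c k = 0"
  using deg sum
proof (induction N arbitrary: c)
  case (Suc N)
  have split: "(\<Sum>k\<le>Suc N. c k * A ^ k * B ^ (Suc N - k)) =
      c 0 * B ^ Suc N + A * (\<Sum>k\<le>N. c (Suc k) * A ^ k * B ^ (N - k))"
    by (subst sum.atMost_Suc_shift) (simp add: sum_distrib_left mult_ac)
  then have "c 0 * B ^ Suc N = A * - (\<Sum>k\<le>N. c (Suc k) * A ^ k * B ^ (N - k))"
    using Suc.prems(2) by (simp add: add_eq_0_iff2)
  then have "A dvd c 0 * B ^ Suc N" by simp
  then have "A dvd c 0" by (rule dvd_mult_power_bezoutD[OF cop])
  then have c0: "c 0 = 0" using Suc.prems(1)[of 0] by (auto dest: dvd_imp_degree_le)
  then have "(\<Sum>k\<le>N. c (Suc k) * A ^ k * B ^ (N - k)) = 0"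
    using split Suc.prems(2) A by simp
  then have "\<forall>k\<le>N. c (Suc k) = 0"
    using Suc.prems(1) by (intro Suc.IH) auto
  then show ?case using c0 by (metis Suc_le_mono not0_implies_Suc)
qed simp


lemma rat_poly_eval_sum:
  "poly (map_poly of_rat (\<Sum>i\<in>I. p i :: rat poly)) (x::real) = (\<Sum>i\<in>I. poly (map_poly of_rat (p i)) x)"
  by (simp add: rat_ext.mp.hom_sum poly_sum)

section \<open>The field generated by the transcendental number\<close>

context
  fixes \<gamma> :: real
  assumes transcendental: "\<not> algebraic \<gamma>"
begin

definition eval_gamma :: "rat poly \<Rightarrow> real" where
  "eval_gamma p = poly (map_poly of_rat p) \<gamma>"

text \<open>Transcendence says that evaluation at \<gamma> has trivial kernel, so the fraction field
  of \<open>rat poly\<close> becomes a copy of the field generated by \<gamma> in the reals.\<close>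

lemma inj_idom_hom_eval_gamma: "inj_idom_hom eval_gamma"
proof
  show "p = 0" if "eval_gamma p = 0" for p
    using that transcendental unfolding real_algebraic_iff eval_gamma_def by blast
qed (simp_all add: eval_gamma_def hom_distribs)

interpretation gext: field_extension "fract_lift eval_gamma"
  using field_hom_fract_lift[OF inj_idom_hom_eval_gamma] by (simp add: field_extension_def)

lemma fract_lift_whole: "fract_lift eval_gamma (Fract p 1) = eval_gamma p"
  by (simp add: fract_lift_Fract[OF inj_idom_hom_eval_gamma]) (simp add: eval_gamma_def)

definition gamma_var :: "rat poly fract" where
  "gamma_var = Fract [:0, 1:] 1"

definition rat_const :: "rat \<Rightarrow> rat poly fract" where
  "rat_const q = Fract [:q:] 1"

lemma lift_gamma_var: "fract_lift eval_gamma gamma_var = \<gamma>"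
  by (simp add: gamma_var_def fract_lift_whole eval_gamma_def hom_distribs)

lemma lift_rat_const: "fract_lift eval_gamma (rat_const q) = of_rat q"
  by (simp add: rat_const_def fract_lift_whole eval_gamma_def hom_distribs)

text \<open>This replaces irreducibility over \<open>\<rat>(\<gamma>)\<close>: since \<open>\<gamma> = A(x) / B(x)\<close>, the root \<open>x\<close> is transcendental, so
  clearing denominators turns \<open>a(x) = 0\<close> into a polynomial identity that is homogeneous in \<open>A\<close> and \<open>B\<close>.\<close>

lemma no_small_annihilator:
  fixes \<theta> :: rat and x :: real
  assumes m: "m > 0" and root: "poly (looped_path_poly \<gamma> (of_rat \<theta>) m) x = 0"
    and a: "a \<noteq> 0" "degree a < m"
  shows "gext.ev a x \<noteq> 0"
proof
  assume ev0: "gext.ev a x = 0"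
  define A B where "A = looped_path_poly 0 \<theta> m" and "B = trimmed_path_poly \<theta> m"
  obtain C D where bez: "A * C + B * D = 1"
    using looped_trimmed_bezout[OF m, of \<theta>] by (auto simp: A_def B_def)
  define A' B' where "A' = rat_ext.ev A x" and "B' = rat_ext.ev B x"
  have "A' * rat_ext.ev C x + B' * rat_ext.ev D x = rat_ext.ev (A * C + B * D) x"
    by (simp add: A'_def B'_def rat_ext.mp.hom_add rat_ext.mp.hom_mult)
  then have bez': "A' * rat_ext.ev C x + B' * rat_ext.ev D x = 1"
    using bez by simp
  have eq: "A' = \<gamma> * B'"
    using root unfolding looped_path_poly_linear[OF m, of \<gamma>]
    by (simp add: A'_def B'_def A_def B_def of_rat_hom.map_poly_looped_path_poly
        of_rat_hom.map_poly_trimmed_path_poly)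
  \<comment> \<open>If \<open>B'\<close> vanished, so would \<open>A'\<close>, contrary to the
    Bezout identity evaluated at \<open>x\<close>.\<close>
  have B': "B' \<noteq> 0" using bez' eq by auto
  have trans_x: "\<not> algebraic x"
    using algebraic_if_mult_eq[of x \<gamma> B A] transcendental eq B' by (auto simp: A'_def B'_def)
  obtain d n where dn: "d \<noteq> 0" "map_poly (\<lambda>c. Fract c 1) n = smult (Fract d 1) a"
    using clear_denominators by blast
  have coeff_n: "Fract (coeff n i) 1 = Fract d 1 * coeff a i" for i
    using arg_cong[OF dn(2), of "\<lambda>p. coeff p i"] by (simp add: coeff_map_poly Zero_fract_def)
  define N where "N = Max ((\<lambda>i. degree (coeff n i)) ` {..<m})"
  have N: "degree (coeff n i) \<le> N" if "i < m" for i
    unfolding N_def using that by (intro Max_ge) auto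
  \<comment> \<open>\<open>n\<close> is a polynomial in two variables; \<open>c k\<close> is its
    coefficient at the \<open>k\<close>-th power of \<gamma>, as a polynomial in the variable
    evaluated at \<open>x\<close>.\<close>
  define c where "c k = (\<Sum>i<m. monom (coeff (coeff n i) k) i)" for k
  have deg_c: "degree (c k) < degree A" for k
  proof -
    have "degree (c k) \<le> m - 1"
      unfolding c_def by (intro degree_sum_le) (auto intro: degree_monom_le[THEN order_trans])
    then show ?thesis using m by (simp add: A_def)
  qed
  have "(\<Sum>i<m. eval_gamma (coeff n i) * x ^ i) = (\<Sum>i<m. eval_gamma d * (fract_lift eval_gamma (coeff a i) * x ^ i))"
  proof (rule sum.cong[OF refl])
    fix i
    have "eval_gamma (coeff n i) = eval_gamma d * fract_lift eval_gamma (coeff a i)"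
      using arg_cong[OF coeff_n[of i], of "fract_lift eval_gamma"]
      by (simp add: fract_lift_whole gext.hom_mult)
    then show "eval_gamma (coeff n i) * x ^ i = eval_gamma d * (fract_lift eval_gamma (coeff a i) * x ^ i)"
      by simp
  qed
  also have "\<dots> = eval_gamma d * (\<Sum>i<m. fract_lift eval_gamma (coeff a i) * x ^ i)"
    by (simp add: sum_distrib_left)
  also have "(\<Sum>i<m. fract_lift eval_gamma (coeff a i) * x ^ i) = gext.ev a x"
    unfolding gext.ev_eq_sum using a(2)
    by (intro sum.mono_neutral_right) (auto simp: coeff_eq_0)
  finally have zero: "(\<Sum>i<m. eval_gamma (coeff n i) * x ^ i) = 0" using ev0 by simp
  have eval_n: "eval_gamma (coeff n i) = (\<Sum>k\<le>N. of_rat (coeff (coeff n i) k) * \<gamma> ^ k)" if "i < m" for i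
  proof -
    have "eval_gamma (coeff n i) = (\<Sum>k\<le>degree (coeff n i). of_rat (coeff (coeff n i) k) * \<gamma> ^ k)"
      by (simp add: eval_gamma_def poly_altdef)
    also have "\<dots> = (\<Sum>k\<le>N. of_rat (coeff (coeff n i) k) * \<gamma> ^ k)"
      using N[OF that] by (intro sum.mono_neutral_left) (auto simp: coeff_eq_0)
    finally show ?thesis .
  qed
  \<comment> \<open>This is the value of \<open>n\<close> with \<gamma> replaced by
    \<open>A' / B'\<close>, multiplied by \<open>B' ^ N\<close> to clear the denominators.\<close>
  have "rat_ext.ev (\<Sum>k\<le>N. c k * A ^ k * B ^ (N - k)) x = (\<Sum>k\<le>N. rat_ext.ev (c k) x * A' ^ k * B' ^ (N - k))"
    by (simp add: rat_poly_eval_sum A'_def B'_def rat_ext.mp.hom_mult rat_ext.mp.hom_power)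
  also have "\<dots> = (\<Sum>k\<le>N. \<Sum>i<m. B' ^ N * (of_rat (coeff (coeff n i) k) * \<gamma> ^ k * x ^ i))"
  proof (rule sum.cong[OF refl])
    fix k assume "k \<in> {..N}"
    then have AB: "A' ^ k * B' ^ (N - k) = \<gamma> ^ k * B' ^ N"
      unfolding eq by (simp add: power_mult_distrib flip: power_add)
    have "rat_ext.ev (c k) x = (\<Sum>i<m. of_rat (coeff (coeff n i) k) * x ^ i)"
      by (simp add: c_def rat_poly_eval_sum poly_monom)
    then show "rat_ext.ev (c k) x * A' ^ k * B' ^ (N - k) =
        (\<Sum>i<m. B' ^ N * (of_rat (coeff (coeff n i) k) * \<gamma> ^ k * x ^ i))"
      unfolding mult.assoc AB by (simp add: sum_distrib_left mult_ac)
  qed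
  also have "\<dots> = (\<Sum>i<m. \<Sum>k\<le>N. B' ^ N * (of_rat (coeff (coeff n i) k) * \<gamma> ^ k * x ^ i))"
    by (rule sum.swap)
  also have "\<dots> = B' ^ N * (\<Sum>i<m. eval_gamma (coeff n i) * x ^ i)"
    by (simp add: sum_distrib_left sum_distrib_right eval_n)
  finally have "rat_ext.ev (\<Sum>k\<le>N. c k * A ^ k * B ^ (N - k)) x = 0"
    using zero by simp
  then have "(\<Sum>k\<le>N. c k * A ^ k * B ^ (N - k)) = 0"
    using trans_x unfolding real_algebraic_iff by blast
  then have c0: "\<forall>k\<le>N. c k = 0"
    using homogeneous_combination_eq_0[OF bez _ _, of N c] deg_c by force
  have "coeff n i = 0" if "i < m" for i
  proof (rule poly_eqI)
    fix k
    have "coeff (c k) i = coeff (coeff n i) k"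
      using that by (simp add: c_def coeff_sum)
    then show "coeff (coeff n i) k = coeff 0 k"
      using c0 N[OF that] by (cases "k \<le> N") (auto simp: coeff_eq_0)
  qed
  then have "Fract d 1 * lead_coeff a = 0"
    using coeff_n[of "degree a"] a(2) by (simp add: Zero_fract_def)
  moreover have "Fract d 1 \<noteq> 0" using dn(1) by (simp add: Zero_fract_def eq_fract)
  ultimately show False using a(1) by simp
qed

text \<open>By \<open>no_small_annihilator\<close> the trace argument applies with degree
  \<open>m\<close> and replaces each \<open>x i\<close> by \<gamma> + \<open>\<theta> i\<close>. The
  result is a polynomial in \<gamma> of degree at most 1 over the rationals, so its two coefficients
  vanish separately.\<close>

theorem root_relation:
  fixes \<theta> :: "'i \<Rightarrow> rat" and x :: "'i \<Rightarrow> real" and l :: "'i \<Rightarrow> int"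
  assumes m: "m > 0" and "finite I"
    and root: "\<And>i. i \<in> I \<Longrightarrow> poly (looped_path_poly \<gamma> (of_rat (\<theta> i)) m) (x i) = 0"
    and rel: "(\<Sum>i\<in>I. of_int (l i) * x i) = 0"
  shows "(\<Sum>i\<in>I. l i) = 0" "(\<Sum>i\<in>I. of_int (l i) * \<theta> i) = 0"
proof -
  let ?h = "fract_lift eval_gamma"
  define p where "p i = looped_path_poly gamma_var (rat_const (\<theta> i)) m" for i
  have ev: "gext.ev (p i) (x i) = 0" if "i \<in> I" for i
    using root[OF that] by (simp add: p_def gext.map_poly_looped_path_poly lift_gamma_var lift_rat_const)
  have lint: "?h (of_int z) = of_int z" for z
    by (simp add: hom_distribs)
  have char0: "of_nat k \<noteq> (0 :: rat poly fract)" if "k > 0" for k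
  proof
    assume "of_nat k = (0 :: rat poly fract)"
    then have "?h (of_nat k) = ?h 0" by simp
    then show False using that by (simp add: hom_distribs)
  qed
  have min: "gext.ev a (x i) \<noteq> 0" if "i \<in> I" "a \<noteq> 0" "degree a < m" for i a
    using no_small_annihilator[OF m root that(2,3)] that(1) .
  have "(\<Sum>i\<in>I. of_int (l i) * coeff (p i) (m - 1)) = 0"
    by (rule gext.sum_trace_coeff_eq_0[OF assms(2) char0 _ _ ev min])
      (use m rel monic_looped_path_poly[OF m] in \<open>simp_all add: p_def lint\<close>)
  then have "?h (\<Sum>i\<in>I. of_int (l i) * (gamma_var + rat_const (\<theta> i))) = 0"
    unfolding p_def coeff_looped_path_poly(2)[OF m] mult_minus_right sum_negf by simp
  then have "(\<Sum>i\<in>I. of_int (l i) * (\<gamma> + of_rat (\<theta> i))) = 0"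
    by (simp add: hom_distribs lift_gamma_var lift_rat_const)
  then have sum: "of_int (\<Sum>i\<in>I. l i) * \<gamma> + of_rat (\<Sum>i\<in>I. of_int (l i) * \<theta> i) = 0"
    by (simp add: algebra_simps sum.distrib sum_distrib_right sum_distrib_left of_rat_sum of_rat_mult)
  let ?q = "[:\<Sum>i\<in>I. of_int (l i) * \<theta> i, of_int (\<Sum>i\<in>I. l i):]"
  have "eval_gamma ?q = 0" using sum by (simp add: eval_gamma_def hom_distribs algebra_simps)
  then have "?q = 0"
    using transcendental unfolding real_algebraic_iff eval_gamma_def by blast
  then show "(\<Sum>i\<in>I. l i) = 0" "(\<Sum>i\<in>I. of_int (l i) * \<theta> i) = 0"
    by (simp_all del: of_int_sum)
qed

end

section \<open>Kronecker approximation under integer relations\<close>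

lemma common_denominator:
  assumes "finite (Q :: rat set)"
  shows "\<exists>N::int. N > 0 \<and> (\<forall>q\<in>Q. \<exists>z::int. q * of_int N = of_int z)"
  using assms
proof (induction Q)
  case (insert q Q)
  then obtain N :: int where N: "N > 0" "\<forall>q\<in>Q. \<exists>z::int. q * of_int N = of_int z" by blast
  obtain a b where ab: "quotient_of q = (a, b)" by (cases "quotient_of q")
  then have q: "q = of_int a / of_int b" "b > 0"
    using quotient_of_div quotient_of_denom_pos by auto
  have "\<exists>z::int. r * of_int (N * b) = of_int z" if r: "r \<in> insert q Q" for r
  proof (cases "r = q")
    case True
    then show ?thesis using q by (intro exI[of _ "a * N"]) simp
  next
    case False
    then obtain z :: int where "r * of_int N = of_int z" using N r by auto
    then show ?thesis by (intro exI[of _ "z * b"]) (simp flip: mult.assoc)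
  qed
  then show ?case using N q by (intro exI[of _ "N * b"]) auto
qed (auto intro!: exI[of _ 1])

text \<open>Rational independence survives the division by \<open>N\<close> and contains the integer
  independence that \<open>Kronecker_thm_1\<close> asks for; the rest converts between
  \<open>B\<close> and an enumeration of it.\<close>

lemma kronecker_basis:
  fixes B :: "real set" and f :: "real \<Rightarrow> real"
  assumes B: "finite B" "rat_ext.independent B" and "\<delta> > 0" "N > (0::real)" "N \<in> \<rat>"
  shows "\<exists>t h. \<forall>b\<in>B. \<bar>t * (b / N) - of_int (h b) - f b\<bar> < \<delta>"
proof -
  obtain g where g: "bij_betw g {..<card B} B"
    using ex_bij_betw_nat_finite[OF B(1)] by (auto simp: atLeast0LessThan)
  interpret Zmod: Modules.module "\<lambda>r x. real_of_int r * x"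
    by unfold_locales (simp_all add: algebra_simps)
  let ?\<theta> = "\<lambda>i. g i / N"
  have inj: "inj_on ?\<theta> {..<card B}"
    using g \<open>N > 0\<close> by (auto simp: bij_betw_def inj_on_def)
  have indep: "Zmod.independent (?\<theta> ` {..<card B})"
  proof (rule ccontr)
    assume "\<not> Zmod.independent (?\<theta> ` {..<card B})"
    then obtain u where u: "\<exists>v\<in>?\<theta> ` {..<card B}. u v \<noteq> 0" "(\<Sum>v\<in>?\<theta> ` {..<card B}. real_of_int (u v) * v) = 0"
      by (auto simp: Zmod.dependent_finite)
    have "?\<theta> ` {..<card B} = (\<lambda>b. b / N) ` (g ` {..<card B})" by (simp add: image_image)
    then have im: "?\<theta> ` {..<card B} = (\<lambda>b. b / N) ` B"
      unfolding bij_betw_imp_surj_on[OF g] .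
    have injN: "inj_on (\<lambda>b. b / N) B" using \<open>N > 0\<close> by (auto simp: inj_on_def)
    have "(\<Sum>b\<in>B. of_rat (of_int (u (b / N))) * b) = N * (\<Sum>b\<in>B. real_of_int (u (b / N)) * (b / N))"
      using \<open>N > 0\<close> by (simp add: sum_distrib_left)
    also have "\<dots> = 0" using u(2) unfolding im sum.reindex[OF injN] by simp
    finally have "\<forall>b\<in>B. of_int (u (b / N)) = (0 :: rat)"
      using B(2) rat_ext.independentD[OF B(2) B(1) order_refl, of "\<lambda>b. of_int (u (b / N))"] by blast
    then show False using u(1) unfolding im by auto
  qed
  obtain t h where th: "\<And>i. i < card B \<Longrightarrow> \<bar>t * ?\<theta> i - of_int (h i) - f (g i)\<bar> < \<delta>"
    using Kronecker_thm_1[OF indep inj \<open>\<delta> > 0\<close>, of "\<lambda>i. f (g i)"] by blast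
  have "\<bar>t * (b / N) - of_int (h (inv_into {..<card B} g b)) - f b\<bar> < \<delta>" if "b \<in> B" for b
    using th[of "inv_into {..<card B} g b"] that g
    by (metis bij_betw_def f_inv_into_f inv_into_into lessThan_iff)
  then show ?thesis
    by (intro exI[of _ t] exI[of _ "\<lambda>b. h (inv_into {..<card B} g b)"]) blast
qed

text \<open>Kronecker's theorem is applied to a rational basis of the span of the \<open>x i\<close>, divided by a common
  denominator \<open>N\<close> of the coordinates so that the \<open>x i\<close> become integer combinations.\<close>

theorem kronecker_relations:
  fixes x \<phi> :: "'i \<Rightarrow> real"
  assumes I: "finite I" and "\<epsilon> > 0"
    and rel: "\<And>l :: 'i \<Rightarrow> int. (\<Sum>i\<in>I. of_int (l i) * x i) = 0 \<Longrightarrow> (\<Sum>i\<in>I. of_int (l i) * \<phi> i) = 0"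
  shows "\<exists>t h. \<forall>i\<in>I. \<bar>t * x i - of_int (h i) - \<phi> i\<bar> < \<epsilon>"
proof -
  obtain B where B: "B \<subseteq> x ` I" "rat_ext.independent B" "x ` I \<subseteq> rat_ext.span B"
    using rat_ext.maximal_independent_subset[of "x ` I"] by blast
  have finB: "finite B" using B(1) I finite_subset by blast
  have "\<forall>b\<in>B. \<exists>i\<in>I. x i = b" using B(1) by auto
  then obtain e where e: "\<And>b. b \<in> B \<Longrightarrow> e b \<in> I \<and> x (e b) = b" by metis
  define r where "r i b = rat_ext.representation B (x i) b" for i b
  have xr: "x i = (\<Sum>b\<in>B. of_rat (r i b) * b)" if "i \<in> I" for i
    unfolding r_def using rat_ext.sum_representation_eq[OF B(2) _ finB order_refl, of "x i"] B(3) that by auto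
  obtain N :: int where N: "N > 0" "\<forall>q\<in>(\<lambda>(i, b). r i b) ` (I \<times> B). \<exists>z::int. q * of_int N = of_int z"
    using common_denominator[of "(\<lambda>(i, b). r i b) ` (I \<times> B)"] I finB by blast
  then have "\<forall>i\<in>I. \<forall>b\<in>B. \<exists>z::int. r i b * of_int N = of_int z" by auto
  then obtain z :: "'i \<Rightarrow> real \<Rightarrow> int" where z: "\<And>i b. i \<in> I \<Longrightarrow> b \<in> B \<Longrightarrow> r i b * of_int N = of_int (z i b)"
    by metis
  have z': "of_rat (r i b) * real_of_int N = real_of_int (z i b)" if "i \<in> I" "b \<in> B" for i b
    using arg_cong[OF z[OF that], of "of_rat :: rat \<Rightarrow> real"] by (simp add: of_rat_mult)
  have xz: "x i = (\<Sum>b\<in>B. real_of_int (z i b) * (b / N))" if "i \<in> I" for i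
    unfolding xr[OF that] using z'[OF that] N(1)
    by (intro sum.cong refl) (simp add: field_simps flip: z'[OF that])
  have \<phi>z: "\<phi> i = (\<Sum>b\<in>B. real_of_int (z i b) * (\<phi> (e b) / N))" if i: "i \<in> I" for i
  proof -
    \<comment> \<open>This \<open>l\<close> encodes the relation that expresses \<open>N\<close>
      times \<open>x i\<close> through the basis elements \<open>x (e b)\<close>. Hypothesis
      \<open>rel\<close> then gives \<phi> the same coordinates; sums of indicators are used since
      \<open>e b\<close> may equal \<open>i\<close>.\<close>
    define l where "l j = N * of_bool (j = i) - (\<Sum>b\<in>B. z i b * of_bool (j = e b))" for j
    have sum_l: "(\<Sum>j\<in>I. real_of_int (l j) * w j) = N * w i - (\<Sum>b\<in>B. real_of_int (z i b) * w (e b))" for w :: "'i \<Rightarrow> real"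
    proof -
      have "(\<Sum>j\<in>I. real_of_int (l j) * w j) =
          (\<Sum>j\<in>I. real_of_int N * (of_bool (j = i) * w j)) - (\<Sum>j\<in>I. \<Sum>b\<in>B. real_of_int (z i b) * (of_bool (j = e b) * w j))"
        by (simp add: l_def left_diff_distrib sum_subtractf sum_distrib_right mult.assoc)
      also have "(\<Sum>j\<in>I. real_of_int N * (of_bool (j = i) * w j)) = N * w i"
        using I i by (simp add: sum_distrib_left[symmetric] of_bool_def if_distrib[of "\<lambda>c. c * _"] cong: if_cong)
      also have "(\<Sum>j\<in>I. \<Sum>b\<in>B. real_of_int (z i b) * (of_bool (j = e b) * w j)) =
          (\<Sum>b\<in>B. \<Sum>j\<in>I. real_of_int (z i b) * (of_bool (j = e b) * w j))"
        by (rule sum.swap)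
      also have "\<dots> = (\<Sum>b\<in>B. real_of_int (z i b) * w (e b))"
        using I e by (intro sum.cong refl)
          (simp add: sum_distrib_left[symmetric] of_bool_def if_distrib[of "\<lambda>c. c * _"] cong: if_cong)
      finally show ?thesis .
    qed
    have "(\<Sum>b\<in>B. real_of_int (z i b) * x (e b)) = (\<Sum>b\<in>B. real_of_int (z i b) * b)"
      using e by (intro sum.cong) auto
    also have "\<dots> = N * x i"
      unfolding xz[OF i] using N(1) by (simp add: sum_distrib_left)
    finally have "(\<Sum>j\<in>I. real_of_int (l j) * x j) = 0" unfolding sum_l by simp
    then have "(\<Sum>j\<in>I. real_of_int (l j) * \<phi> j) = 0" by (rule rel)
    then show ?thesis unfolding sum_l using N(1)
      by (simp add: sum_divide_distrib[symmetric] field_simps)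
  qed
  \<comment> \<open>\<open>K\<close> strictly exceeds the sum of the absolute coordinates of every
    \<open>x i\<close>, so errors \<open>\<epsilon> / K\<close> on the basis add up to less than
    \<epsilon>.\<close>
  define K where "K = 1 + (\<Sum>i\<in>I. \<Sum>b\<in>B. \<bar>real_of_int (z i b)\<bar>)"
  have K: "K > 0" unfolding K_def by (intro add_pos_nonneg sum_nonneg) auto
  obtain t h where th: "\<And>b. b \<in> B \<Longrightarrow> \<bar>t * (b / N) - of_int (h b) - \<phi> (e b) / N\<bar> < \<epsilon> / K"
    using kronecker_basis[OF finB B(2), of "\<epsilon> / K" "real_of_int N" "\<lambda>b. \<phi> (e b) / N"] K N(1) \<open>\<epsilon> > 0\<close> by auto
  have "\<bar>t * x i - of_int (\<Sum>b\<in>B. z i b * h b) - \<phi> i\<bar> < \<epsilon>" if i: "i \<in> I" for i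
  proof -
    have "t * x i - of_int (\<Sum>b\<in>B. z i b * h b) - \<phi> i =
        (\<Sum>b\<in>B. real_of_int (z i b) * (t * (b / N) - of_int (h b) - \<phi> (e b) / N))"
      unfolding xz[OF i] \<phi>z[OF i]
      by (simp add: sum_distrib_left sum_subtractf right_diff_distrib mult_ac)
    also have "\<bar>\<dots>\<bar> \<le> (\<Sum>b\<in>B. \<bar>real_of_int (z i b)\<bar> * (\<epsilon> / K))"
      using less_imp_le[OF th]
      by (intro order.trans[OF sum_abs] sum_mono) (simp only: abs_mult mult_left_mono abs_ge_zero)
    also have "\<dots> = (\<Sum>b\<in>B. \<bar>real_of_int (z i b)\<bar>) * (\<epsilon> / K)"
      by (rule sum_distrib_right[symmetric])
    also have "\<dots> < K * (\<epsilon> / K)"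
    proof (rule mult_strict_right_mono)
      have "(\<Sum>b\<in>B. \<bar>real_of_int (z i b)\<bar>) \<le> (\<Sum>i\<in>I. \<Sum>b\<in>B. \<bar>real_of_int (z i b)\<bar>)"
        using I i by (intro member_le_sum[of i I "\<lambda>i. \<Sum>b\<in>B. \<bar>real_of_int (z i b)\<bar>"]) (auto intro: sum_nonneg)
      then show "(\<Sum>b\<in>B. \<bar>real_of_int (z i b)\<bar>) < K" by (simp add: K_def)
      show "0 < \<epsilon> / K" using K \<open>\<epsilon> > 0\<close> by simp
    qed
    also have "\<dots> = \<epsilon>" using K by simp
    finally show ?thesis .
  qed
  then show ?thesis
    by (intro exI[of _ t] exI[of _ "\<lambda>i. \<Sum>b\<in>B. z i b * h b"] ballI)
qed

section \<open>Spectral decomposition of the rooted product\<close>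

text \<open>At two roots of \<open>looped_path_poly\<close> with the same parameters the right-hand
  side vanishes. Taking a root and its conjugate yields reality of the roots; taking two distinct
  roots yields orthogonality of the eigenvectors.\<close>

lemma christoffel_darboux:
  fixes g x y :: "'a::comm_ring_1"
  assumes "m > 0"
  shows "(x - y) * (\<Sum>s<m. poly (path_poly g s) x * poly (path_poly g s) y) =
    poly (path_poly g m) x * poly (path_poly g (m - 1)) y -
    poly (path_poly g (m - 1)) x * poly (path_poly g m) y"
  using assms
proof (induction m rule: nat_induct_non_zero)
  case (Suc m)
  then obtain r where r: "m = Suc r" by (cases m) auto
  show ?case using Suc.IH by (simp add: r algebra_simps)
qed simp

text \<open>The confluent case, where both points coincide and derivatives replace the difference
  quotient. It shows that the roots are simple.\<close>

lemma christoffel_darboux_diagonal: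
  assumes "m > 0"
  shows "pderiv (path_poly g m) * path_poly g (m - 1) - pderiv (path_poly g (m - 1)) * path_poly g m =
    (\<Sum>s<m. path_poly g s ^ 2 :: 'a::idom poly)"
  using assms
proof (induction m rule: nat_induct_non_zero)
  case 1
  then show ?case by (simp add: pderiv_pCons)
next
  case (Suc m)
  then obtain r where r: "m = Suc r" by (cases m) auto
  have "pderiv (path_poly g (Suc m)) =
      path_poly g m + [:0, 1:] * pderiv (path_poly g m) - pderiv (path_poly g r)"
    unfolding r path_poly.simps(3) pderiv_diff pderiv_mult
    by (simp add: pderiv_diff pderiv_pCons)
  moreover have "path_poly g (Suc m) = [:0, 1:] * path_poly g m - path_poly g r" by (simp add: r)
  moreover have "(P + X * P' - R') * P - P' * (X * P - R) = P ^ 2 + (P' * R - R' * P)" for P P' R R' X :: "'a poly"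
    by (simp add: algebra_simps power2_eq_square)
  ultimately have "pderiv (path_poly g (Suc m)) * path_poly g m - pderiv (path_poly g m) * path_poly g (Suc m) =
      path_poly g m ^ 2 + (pderiv (path_poly g m) * path_poly g r - pderiv (path_poly g r) * path_poly g m)"
    by (simp only:)
  then show ?case using Suc.IH by (simp add: r del: path_poly.simps)
qed

text \<open>In Christoffel--Darboux at \<open>z\<close> and its conjugate the sum consists of
  squared moduli and contains the term 1 from \<open>s = 0\<close>, so the factor
  \<open>z - cnj z\<close> must vanish.\<close>

lemma looped_path_poly_root_real:
  fixes z :: complex
  assumes m: "m > 0" and root: "poly (looped_path_poly (of_real g) (of_real \<theta>) m) z = 0"
  shows "z \<in> \<real>"
proof -
  let ?q = "\<lambda>s. poly (path_poly (complex_of_real g) s)"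
  have cnj: "?q s (cnj w) = cnj (?q s w)" for s w
    by (induction s rule: induct_nat_012) simp_all
  have eq: "?q m z = of_real \<theta> * ?q (m - 1) z"
    using root by (simp add: looped_path_poly_def)
  define S where "S = (\<Sum>s<m. (cmod (?q s z))\<^sup>2)"
  have "of_real S = (\<Sum>s<m. ?q s z * ?q s (cnj z))"
    unfolding cnj S_def by (simp flip: complex_norm_square)
  then have "(z - cnj z) * of_real S = 0"
    using christoffel_darboux[OF m, of z "cnj z" "complex_of_real g"] unfolding cnj eq by simp
  moreover have "(cmod (?q 0 z))\<^sup>2 \<le> S"
    unfolding S_def using m by (intro member_le_sum) auto
  then have "S \<noteq> 0" by auto
  ultimately have "z = cnj z" by simp
  then show ?thesis by (metis Reals_cnj_iff)
qed

section \<open>The spectrum of the path with two loops\<close>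

definition looped_path_spectrum :: "real \<Rightarrow> real \<Rightarrow> nat \<Rightarrow> real set" where
  "looped_path_spectrum g \<theta> m = {x. poly (looped_path_poly g \<theta> m) x = 0}"

lemma sum_path_poly_sq_pos:
  assumes "m > 0"
  shows "(\<Sum>s<m. (poly (path_poly g s) x)\<^sup>2) > (0 :: real)"
proof -
  have "(poly (path_poly g 0) x)\<^sup>2 \<le> (\<Sum>s<m. (poly (path_poly g s) x)\<^sup>2)"
    using assms by (intro member_le_sum) auto
  then show ?thesis by simp
qed

text \<open>Over the complex numbers the polynomial splits. All its roots are real, and a double
  root would make the sum of squares in the diagonal formula vanish.\<close>

lemma card_looped_path_spectrum:
  assumes m: "m > 0"
  shows "card (looped_path_spectrum g \<theta> m) = m" "finite (looped_path_spectrum g \<theta> m)"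
proof -
  let ?p = "looped_path_poly g \<theta> m"
  let ?P = "looped_path_poly (complex_of_real g) (complex_of_real \<theta>) m"
  have P: "?P = map_poly of_real ?p"
    by (simp add: of_real_hom.map_poly_looped_path_poly)
  have Px: "poly ?P (of_real x) = of_real (poly ?p x)" for x
    unfolding P by simp
  have "poly (pderiv ?p) x \<noteq> 0" if "poly ?p x = 0" for x
  proof
    assume d: "poly (pderiv ?p) x = 0"
    let ?q = "\<lambda>s. poly (path_poly g s) x" and ?d = "\<lambda>s. poly (pderiv (path_poly g s)) x"
    have "?q m = \<theta> * ?q (m - 1)" "?d m = \<theta> * ?d (m - 1)"
      using that d by (simp_all add: looped_path_poly_def pderiv_diff pderiv_smult)
    then have "(\<Sum>s<m. (?q s)\<^sup>2) = 0"
      using arg_cong[OF christoffel_darboux_diagonal[OF m, of g], of "\<lambda>p. poly p x"]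
      by (simp add: poly_sum)
    then show False using sum_path_poly_sq_pos[OF m, of g x] by simp
  qed
  moreover have "poly (pderiv ?P) (of_real x) = of_real (poly (pderiv ?p) x)" for x
    unfolding P by (simp flip: of_real_hom.map_poly_pderiv)
  ultimately have "rsquarefree ?P"
    unfolding rsquarefree_roots
    using looped_path_poly_root_real[OF m, of g \<theta>] Px by (metis Reals_cases of_real_eq_0_iff)
  moreover have "?P \<noteq> 0" using degree_looped_path_poly[OF m, of "complex_of_real g"] m
    by (metis degree_0 less_numeral_extra(3))
  ultimately have "card {z. poly ?P z = 0} = m"
    using rsquarefree_card_degree degree_looped_path_poly[OF m] by metis
  moreover have "{z. poly ?P z = 0} = complex_of_real ` looped_path_spectrum g \<theta> m"
    using looped_path_poly_root_real[OF m, of g \<theta>] Px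
    by (auto simp: looped_path_spectrum_def image_iff) (metis Reals_cases of_real_eq_0_iff)
  ultimately show c: "card (looped_path_spectrum g \<theta> m) = m"
    by (simp add: card_image inj_on_def)
  show "finite (looped_path_spectrum g \<theta> m)" using c m by (metis card.infinite less_irrefl)
qed

text \<open>Christoffel--Darboux makes the eigenvectors orthogonal; this is the dual orthogonality.\<close>

lemma looped_path_spectrum_completeness:
  fixes g \<theta> :: real
  assumes m: "m > 0" and sh: "s < m" "h < m"
  defines "q \<equiv> \<lambda>s x. poly (path_poly g s) x"
  shows "(\<Sum>x\<in>looped_path_spectrum g \<theta> m. q h x / (\<Sum>s<m. (q s x)\<^sup>2) * q s x) = of_bool (s = h)"
proof -
  let ?R = "looped_path_spectrum g \<theta> m"
  define N where "N x = (\<Sum>s<m. (q s x)\<^sup>2)" for x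
  have N: "N x \<noteq> 0" for x using sum_path_poly_sq_pos[OF m, of g x] by (simp add: N_def q_def)
  obtain e where e: "bij_betw e {..<m} ?R"
    using ex_bij_betw_nat_finite[OF card_looped_path_spectrum(2)[OF m]]
    unfolding card_looped_path_spectrum(1)[OF m] by (auto simp: atLeast0LessThan)
  have orth: "(\<Sum>s<m. q s x * q s y) = 0" if "x \<in> ?R" "y \<in> ?R" "x \<noteq> y" for x y
  proof -
    have "q m x = \<theta> * q (m - 1) x" "q m y = \<theta> * q (m - 1) y"
      using that by (simp_all add: looped_path_spectrum_def looped_path_poly_def q_def)
    then have "(x - y) * (\<Sum>s<m. q s x * q s y) = 0"
      using christoffel_darboux[OF m, of x y g] by (simp add: q_def)
    then show ?thesis using that(3) by simp
  qed
  \<comment> \<open>The columns of \<open>B\<close> are the eigenvectors and the rows of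
    \<open>A\<close> the normalised ones. There are exactly \<open>m\<close> eigenvalues, so both
    matrices are square and the one-sided inverse given by orthogonality is two-sided.\<close>
  define A where "A = Matrix.mat m m (\<lambda>(r, s). q s (e r) / N (e r))"
  define B where "B = Matrix.mat m m (\<lambda>(s, r). q s (e r))"
  have "A * B = 1\<^sub>m m"
  proof (rule eq_matI)
    fix r r' assume "r < dim_row (1\<^sub>m m :: real mat)" "r' < dim_col (1\<^sub>m m :: real mat)"
    then have r: "r < m" "r' < m" by simp_all
    have "(A * B) $$ (r, r') = (\<Sum>s<m. q s (e r) / N (e r) * q s (e r'))"
      using r by (simp add: A_def B_def scalar_prod_def lessThan_atLeast0)
    also have "\<dots> = (\<Sum>s<m. q s (e r) * q s (e r')) / N (e r)"
      by (simp add: sum_divide_distrib)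
    also have "\<dots> = of_bool (r = r')"
    proof (cases "r = r'")
      case True
      then show ?thesis using N[of "e r"] by (simp add: N_def power2_eq_square)
    next
      case False
      then have "e r \<noteq> e r'" "e r \<in> ?R" "e r' \<in> ?R"
        using e r by (auto simp: bij_betw_def inj_on_def)
      then show ?thesis using orth False by simp
    qed
    finally show "(A * B) $$ (r, r') = 1\<^sub>m m $$ (r, r')" using r by simp
  qed (simp_all add: A_def B_def)
  then have "B * A = 1\<^sub>m m"
    by (rule mat_mult_left_right_inverse[rotated 2]) (simp_all add: A_def B_def)
  then have "of_bool (s = h) = (B * A) $$ (s, h)" using sh by simp
  also have "\<dots> = (\<Sum>r<m. q s (e r) * (q h (e r) / N (e r)))"
    using sh by (simp add: A_def B_def scalar_prod_def lessThan_atLeast0)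
  also have "\<dots> = (\<Sum>x\<in>?R. q s x * (q h x / N x))"
    by (rule sum.reindex_bij_betw[OF e])
  finally show ?thesis by (simp add: N_def mult.commute)
qed

text \<open>Powers of the matrix act on an eigenvector as powers of the eigenvalue, so the entrywise
  exponential series add up to the scalar one.\<close>

lemma transition_mat_eigenvector:
  fixes H :: "complex mat"
  assumes H: "H \<in> carrier_mat N N" and i: "i < N"
    and eig: "\<And>i. i < N \<Longrightarrow> (\<Sum>l<N. H $$ (i, l) * w l) = \<mu> * w i"
  shows "(\<Sum>l<N. transition_mat H t $$ (i, l) * w l) = exp (- \<i> * of_real t * \<mu>) * w i"
proof -
  define A where "A = (- \<i> * of_real t) \<cdot>\<^sub>m H"
  define \<nu> where "\<nu> = - \<i> * of_real t * \<mu>"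
  have A: "A \<in> carrier_mat N N" using H by (simp add: A_def)
  have eigA: "(\<Sum>l<N. A $$ (i, l) * w l) = \<nu> * w i" if "i < N" for i
  proof -
    have "(\<Sum>l<N. A $$ (i, l) * w l) = (- \<i> * of_real t) * (\<Sum>l<N. H $$ (i, l) * w l)"
      unfolding sum_distrib_left using H that by (intro sum.cong) (auto simp: A_def)
    then show ?thesis using eig[OF that] by (simp add: \<nu>_def)
  qed
  have pow: "(\<Sum>l<N. (A ^\<^sub>m r) $$ (i, l) * w l) = \<nu> ^ r * w i" for r
  proof (induction r)
    case 0
    have "(\<Sum>l<N. (A ^\<^sub>m 0) $$ (i, l) * w l) = (\<Sum>l<N. if l = i then w l else 0)"
      using A i by (intro sum.cong) auto
    then show ?case using i by simp
  next
    case (Suc r)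
    have "(\<Sum>l<N. (A ^\<^sub>m Suc r) $$ (i, l) * w l) = (\<Sum>l<N. \<Sum>p<N. (A ^\<^sub>m r) $$ (i, p) * (A $$ (p, l) * w l))"
      using A i pow_carrier_mat[OF A, of r]
      by (intro sum.cong) (auto simp: scalar_prod_def lessThan_atLeast0 sum_distrib_right mult.assoc)
    also have "\<dots> = (\<Sum>p<N. \<Sum>l<N. (A ^\<^sub>m r) $$ (i, p) * (A $$ (p, l) * w l))"
      by (rule sum.swap)
    also have "\<dots> = (\<Sum>p<N. (A ^\<^sub>m r) $$ (i, p) * (\<nu> * w p))"
      by (intro sum.cong) (simp_all add: eigA flip: sum_distrib_left)
    also have "\<dots> = \<nu> * (\<Sum>p<N. (A ^\<^sub>m r) $$ (i, p) * w p)"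
      by (simp add: sum_distrib_left mult_ac)
    finally show ?case using Suc.IH by simp
  qed
  have "(\<lambda>r. (A ^\<^sub>m r) $$ (i, l) / fact r * w l) sums (transition_mat H t $$ (i, l) * w l)" if "l < N" for l
  proof -
    have "transition_mat H t $$ (i, l) = (\<Sum>r. (A ^\<^sub>m r) $$ (i, l) / fact r)"
      unfolding transition_mat_def mat_exp_def A_def[symmetric] using A i that by simp
    then show ?thesis
      using summable_norm_cancel[OF summable_mat_exp[OF A i that]]
      by (intro sums_mult2) (simp add: summable_sums)
  qed
  then have "(\<lambda>r. \<Sum>l<N. (A ^\<^sub>m r) $$ (i, l) / fact r * w l) sums (\<Sum>l<N. transition_mat H t $$ (i, l) * w l)"
    by (intro sums_sum) simp
  moreover have "(\<Sum>l<N. (A ^\<^sub>m r) $$ (i, l) / fact r * w l) = \<nu> ^ r /\<^sub>R fact r * w i" for r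
    using pow[of r] by (simp add: scaleR_conv_of_real field_simps flip: sum_divide_distrib)
  moreover have "(\<lambda>r. \<nu> ^ r /\<^sub>R fact r * w i) sums (exp \<nu> * w i)"
    by (intro sums_mult2 exp_converges)
  ultimately show ?thesis unfolding \<nu>_def by (simp add: sums_unique2)
qed


section \<open>Block structure and eigenvectors of the rooted product\<close>

lemma sum_lessThan_mult:
  fixes f :: "nat \<Rightarrow> 'a::comm_monoid_add"
  shows "(\<Sum>i<m * n. f i) = (\<Sum>p<m. \<Sum>q<n. f (p * n + q))"
proof -
  have "(\<Sum>i<m * n. f i) = (\<Sum>p<m. sum f {p * n..<p * n + n})"
    by (rule sum.nat_group[symmetric])
  also have "\<dots> = (\<Sum>p<m. \<Sum>q<n. f (p * n + q))"
  proof (rule sum.cong[OF refl])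
    fix p
    show "sum f {p * n..<p * n + n} = (\<Sum>q<n. f (p * n + q))"
      using sum.shift_bounds_nat_ivl[of f 0 "p * n" n] by (simp add: lessThan_atLeast0 add.commute)
  qed
  finally show ?thesis .
qed

lemma mult_add_less_mult:
  fixes p q m n :: nat
  assumes "p < m" "q < n"
  shows "p * n + q < m * n"
proof -
  have "p * n + q < Suc p * n" using assms by simp
  also have "\<dots> \<le> m * n" using assms by (intro mult_right_mono) auto
  finally show ?thesis .
qed

lemma index_rooted_product_path:
  assumes "H \<in> carrier_mat n n" "p < m" "q < n" "p' < m" "q' < n"
  shows "rooted_product_path n H m \<gamma> $$ (p * n + q, p' * n + q') =
    of_bool (p = m - 1 \<and> p' = m - 1) * H $$ (q, q') + looped_path_mat m \<gamma> $$ (p, p') * of_bool (q = q')"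
proof -
  have "p * n + q < m * n" "p' * n + q' < m * n"
    using assms by (simp_all add: mult_add_less_mult)
  then show ?thesis
    using assms
    by (auto simp: rooted_product_path_def kronecker_def outer_prod_def looped_path_mat_def)
qed

lemma rooted_product_path_carrier:
  assumes "H \<in> carrier_mat n n"
  shows "rooted_product_path n H m \<gamma> \<in> carrier_mat (m * n) (m * n)"
  using assms by (auto simp: rooted_product_path_def kronecker_def outer_prod_def looped_path_mat_def)

text \<open>Inner rows are the three-term recurrence and the first row is its initial condition. The
  last row would need the entry \<open>y m\<close>, which the root condition supplies as \<theta>
  times \<open>y (m - 1)\<close>.\<close>

lemma looped_path_mat_eigenvector:
  assumes m: "m > 0" and root: "poly (looped_path_poly \<gamma> \<theta> m) x = 0" and p: "p < m"
  defines "y \<equiv> \<lambda>s. complex_of_real (poly (path_poly \<gamma> s) x)"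
  shows "(\<Sum>p'<m. looped_path_mat m \<gamma> $$ (p, p') * y p') + of_bool (p = m - 1) * of_real \<theta> * y (m - 1) =
    of_real x * y p"
proof -
  have rec: "y (Suc (Suc s)) = of_real x * y (Suc s) - y s" for s by (simp add: y_def)
  have base: "y 0 = 1" "y (Suc 0) = of_real x - of_real \<gamma>" by (simp_all add: y_def)
  have end_eq: "y m = of_real \<theta> * y (m - 1)"
    using root by (simp add: y_def looped_path_poly_def flip: of_real_mult)
  have "(\<Sum>p'<m. looped_path_mat m \<gamma> $$ (p, p') * y p') =
      (\<Sum>p'<m. (if p' = 0 then of_bool (p = 0) * of_real \<gamma> * y 0 else 0) +
        (if p' = Suc p then y (Suc p) else 0) + (if Suc p' = p then y p' else 0))"
    using p by (intro sum.cong) (auto simp: looped_path_mat_def)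
  also have "\<dots> = of_bool (p = 0) * of_real \<gamma> + of_bool (p \<noteq> m - 1) * y (Suc p) + of_bool (p > 0) * y (p - 1)"
  proof -
    \<comment> \<open>For \<open>p = 0\<close> the truncated \<open>p - 1\<close> is 0; the factor
      \<open>of_bool (p > 0)\<close> removes this spurious term.\<close>
    have "(\<Sum>p'<m. if Suc p' = p then y p' else 0) = (\<Sum>p'<m. if p' = p - 1 then of_bool (p > 0) * y (p - 1) else 0)"
      by (intro sum.cong) auto
    also have "\<dots> = of_bool (p > 0) * y (p - 1)" using p by auto
    finally show ?thesis using p m by (auto simp: sum.distrib base)
  qed
  finally have sum: "(\<Sum>p'<m. looped_path_mat m \<gamma> $$ (p, p') * y p') =
    of_bool (p = 0) * of_real \<gamma> + of_bool (p \<noteq> m - 1) * y (Suc p) + of_bool (p > 0) * y (p - 1)" .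
  have "of_bool (p \<noteq> m - 1) * y (Suc p) + of_bool (p = m - 1) * of_real \<theta> * y (m - 1) = y (Suc p)"
    using end_eq p by (cases "p = m - 1") auto
  moreover have "of_bool (p = 0) * of_real \<gamma> + y (Suc p) + of_bool (p > 0) * y (p - 1) = of_real x * y p"
    by (cases p) (simp_all add: base rec)
  ultimately show ?thesis unfolding sum by (simp add: algebra_simps)
qed

text \<open>On tensors with second factor \<open>f\<close> the matrix of \<open>X\<close> acts as
  the scalar \<theta>, which leaves the path with the additional loop \<theta> at its root.\<close>

lemma rooted_product_path_eigenvector:
  assumes H: "H \<in> carrier_mat n n" and m: "m > 0" and root: "poly (looped_path_poly \<gamma> \<theta> m) x = 0"
    and f: "\<And>q. q < n \<Longrightarrow> (\<Sum>q'<n. H $$ (q, q') * f q') = of_real \<theta> * f q"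
    and i: "i < m * n"
  defines "w \<equiv> \<lambda>i. complex_of_real (poly (path_poly \<gamma> (i div n)) x) * f (i mod n)"
  shows "(\<Sum>l<m * n. rooted_product_path n H m \<gamma> $$ (i, l) * w l) = of_real x * w i"
proof -
  let ?y = "\<lambda>s. complex_of_real (poly (path_poly \<gamma> s) x)"
  let ?T = "looped_path_mat m \<gamma>"
  have n: "n > 0" using i by (cases n) auto
  define p q where "p = i div n" and "q = i mod n"
  have pq: "p < m" "q < n" "i = p * n + q"
    using i n by (simp_all add: p_def q_def less_mult_imp_div_less)
  have "(\<Sum>l<m * n. rooted_product_path n H m \<gamma> $$ (i, l) * w l) =
      (\<Sum>p'<m. \<Sum>q'<n. of_bool (p = m - 1 \<and> p' = m - 1) * ?y p' * (H $$ (q, q') * f q') +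
        ?T $$ (p, p') * ?y p' * (of_bool (q = q') * f q'))"
    unfolding sum_lessThan_mult pq(3)
  proof (intro sum.cong refl)
    fix p' q' assume "p' \<in> {..<m}" "q' \<in> {..<n}"
    then have p': "p' < m" "q' < n" by simp_all
    then have w: "w (p' * n + q') = ?y p' * f q'" by (simp add: w_def)
    show "rooted_product_path n H m \<gamma> $$ (p * n + q, p' * n + q') * w (p' * n + q') =
        of_bool (p = m - 1 \<and> p' = m - 1) * ?y p' * (H $$ (q, q') * f q') +
        ?T $$ (p, p') * ?y p' * (of_bool (q = q') * f q')"
      unfolding w index_rooted_product_path[OF H pq(1,2) p'] by (simp only: distrib_right distrib_left mult_ac)
  qed
  also have "\<dots> = (\<Sum>p'<m. of_bool (p = m - 1 \<and> p' = m - 1) * ?y p' * (of_real \<theta> * f q) + ?T $$ (p, p') * ?y p' * f q)"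
    using pq f by (intro sum.cong refl) (simp add: sum.distrib flip: sum_distrib_left)
  also have "\<dots> = (of_bool (p = m - 1) * of_real \<theta> * ?y (m - 1) + (\<Sum>p'<m. ?T $$ (p, p') * ?y p')) * f q"
  proof -
    have "(\<Sum>p'<m. of_bool (p = m - 1 \<and> p' = m - 1) * ?y p' * (of_real \<theta> * f q)) =
        (\<Sum>p'<m. if p' = m - 1 then of_bool (p = m - 1) * of_real \<theta> * ?y (m - 1) * f q else 0)"
      by (intro sum.cong) auto
    also have "\<dots> = of_bool (p = m - 1) * of_real \<theta> * ?y (m - 1) * f q"
      using m by simp
    finally show ?thesis by (simp only: sum.distrib sum_distrib_right distrib_right)
  qed
  also have "\<dots> = of_real x * ?y p * f q"
    using looped_path_mat_eigenvector[OF m root pq(1)] by (simp add: add.commute)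
  finally show ?thesis by (simp add: w_def p_def q_def)
qed

section \<open>The Fourier basis\<close>

lemma index_fourier_mat:
  assumes "a < n" "j < n"
  shows "fourier_mat n $$ (a, j) = of_real (1 / sqrt n) * cis (2 * pi * (real a * real j / real n))"
proof -
  have "exp (2 * of_real pi * \<i> / of_nat n) = cis (2 * pi / real n)"
    by (simp add: cis_conv_exp field_simps)
  then have "exp (2 * of_real pi * \<i> / of_nat n) ^ (a * j) = cis (real (a * j) * (2 * pi / real n))"
    by (simp add: Complex.DeMoivre)
  then show ?thesis using assms by (simp add: fourier_mat_def field_simps)
qed

text \<open>A geometric sum whose ratio is an \<open>n\<close>-th root of unity; the ratio is 1 only
  if \<open>n\<close> divides \<open>a - b\<close>, which for indices below \<open>n\<close> means
  \<open>a = b\<close>.\<close>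

lemma fourier_mat_rows_orthonormal:
  assumes "a < n" "b < n"
  shows "(\<Sum>j<n. fourier_mat n $$ (a, j) * cnj (fourier_mat n $$ (b, j))) = of_bool (a = b)"
proof -
  let ?z = "cis (2 * pi * ((real a - real b) / real n))"
  have n: "n > 0" using assms by simp
  have "fourier_mat n $$ (a, j) * cnj (fourier_mat n $$ (b, j)) = ?z ^ j / of_nat n" if "j < n" for j
  proof -
    have "fourier_mat n $$ (a, j) * cnj (fourier_mat n $$ (b, j)) =
        of_real (1 / sqrt n * (1 / sqrt n)) * (cis (2 * pi * (real a * real j / real n)) * cis (- (2 * pi * (real b * real j / real n))))"
      using assms that by (simp only: index_fourier_mat complex_cnj_mult complex_cnj_complex_of_real cis_cnj of_real_mult mult_ac)
    also have "1 / sqrt n * (1 / sqrt n) = 1 / n" using n by (simp add: divide_simps)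
    also have "cis (2 * pi * (real a * real j / real n)) * cis (- (2 * pi * (real b * real j / real n))) = ?z ^ j"
      by (simp add: cis_mult Complex.DeMoivre diff_divide_distrib algebra_simps)
    finally show ?thesis by simp
  qed
  then have "(\<Sum>j<n. fourier_mat n $$ (a, j) * cnj (fourier_mat n $$ (b, j))) = (\<Sum>j<n. ?z ^ j) / of_nat n"
    by (simp add: sum_divide_distrib)
  also have "\<dots> = of_bool (a = b)"
  proof (cases "a = b")
    case True
    then show ?thesis using n by simp
  next
    case False
    have "?z \<noteq> 1"
    proof
      assume "?z = 1"
      then have "cos (2 * pi * ((real a - real b) / real n)) = 1" by (metis cis.sel(1) one_complex.sel(1))
      then obtain k :: int where "2 * pi * ((real a - real b) / real n) = k * 2 * pi"
        by (auto simp: cos_one_2pi_int)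
      then have "2 * pi * ((real a - real b) / real n) = 2 * pi * of_int k" by (simp only: mult_ac)
      then have "(real a - real b) / real n = of_int k" by (subst (asm) mult_left_cancel) simp_all
      then have "real a - real b = real n * of_int k" using n by (simp add: field_simps)
      then have eq: "int a - int b = int n * k" by (metis of_int_diff of_int_eq_iff of_int_mult of_int_of_nat_eq)
      then have "int n dvd int a - int b" by simp
      moreover have "\<bar>int a - int b\<bar> < int n" using assms by linarith
      ultimately show False using False dvd_imp_le_int[of "int a - int b" "int n"] by auto
    qed
    moreover have "?z ^ n = 1"
    proof -
      have "?z ^ n = cis (2 * pi * of_int (int a - int b))"
        using n by (simp add: Complex.DeMoivre)
      also have "\<dots> = 1" by (rule cis_multiple_2pi) simp
      finally show ?thesis .
    qed
    ultimately show ?thesis using False by (simp add: geometric_sum)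
  qed
  finally show ?thesis .
qed



section \<open>State transfer\<close>

lemma cmod_cis_minus_one_le: "cmod (cis x - 1) \<le> \<bar>x\<bar>"
proof -
  have "cmod (cis x - 1) = 2 * \<bar>sin (x / 2)\<bar>"
    using dist_exp_i_1[of x] by (simp add: cis_conv_exp)
  also have "\<dots> \<le> 2 * \<bar>x / 2\<bar>" using abs_sin_x_le_abs_x[of "x / 2"] by linarith
  finally show ?thesis by simp
qed

lemma of_real_of_rat: "complex_of_real (of_rat r) = of_rat r"
  by (cases r) (simp add: of_rat_rat)

theorem theorem5p8:
  fixes n m :: nat
    and c :: "nat \<Rightarrow> complex"
    and H\<^sub>X :: "complex mat"
    and \<theta> :: "nat \<Rightarrow> complex"
    and \<alpha> \<beta> \<gamma> :: real
    and k :: int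
    and c' :: "nat \<Rightarrow> int"
  assumes "n \<ge> 2"
    and "H\<^sub>X = circulant_mat n c"
    and "hermitian_graph n H\<^sub>X"
    and "\<And>j. j < n \<Longrightarrow>
           H\<^sub>X *\<^sub>v (fourier_mat n *\<^sub>v unit_vec n j) = \<theta> j \<cdot>\<^sub>v (fourier_mat n *\<^sub>v unit_vec n j)"
    and "universal_perfect_state_transfer H\<^sub>X"
    and "\<beta> > 0"
    and "coprime k (int n)"
    and "\<And>j. j < n \<Longrightarrow>
           \<theta> j = complex_of_real (\<alpha> + \<beta> * real_of_int (int j * k + c' j * int n))"
    and "\<And>j. j < n \<Longrightarrow> \<theta> j \<in> \<rat>"
    and "\<not> algebraic \<gamma>"
    and "m \<ge> 1"
  shows "\<forall>h. 1 \<le> h \<and> h \<le> m \<longrightarrow>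
           multiple_pretty_good_state_transfer (rooted_product_path n H\<^sub>X m \<gamma>)
             {rooted_vertex n a h | a. a < n}"
proof -
  let ?Z = "rooted_product_path n H\<^sub>X m \<gamma>"
  let ?F = "\<lambda>a j. fourier_mat n $$ (a, j)"
  have m: "m > 0" and n: "n > 0" using assms(1,11) by simp_all
  have H: "H\<^sub>X \<in> carrier_mat n n" using assms(3) by (simp add: hermitian_graph_def)
  have F: "fourier_mat n \<in> carrier_mat n n" by (simp add: fourier_mat_def)
  define E where "E j = int j * k + c' j * int n" for j
  have "\<exists>r. \<theta> j = complex_of_real (of_rat r)" if "j < n" for j
    using assms(9)[OF that] by (metis Rats_cases of_real_of_rat)
  then obtain r where r: "\<And>j. j < n \<Longrightarrow> \<theta> j = complex_of_real (of_rat (r j))" by metis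
  have r_E: "of_rat (r j) = \<alpha> + \<beta> * of_int (E j)" if "j < n" for j
    using r[OF that] assms(8)[OF that] unfolding E_def by (metis of_real_eq_iff)
  have eigX: "(\<Sum>q'<n. H\<^sub>X $$ (q, q') * ?F q' j) = of_real (of_rat (r j)) * ?F q j" if "q < n" "j < n" for q j
  proof -
    have col: "fourier_mat n *\<^sub>v unit_vec n j = Matrix.vec n (\<lambda>a. ?F a j)"
      using F that by (intro eq_vecI) auto
    show ?thesis
      using arg_cong[OF assms(4)[OF that(2)], of "\<lambda>v. v $ q"] that H
      unfolding col r[OF that(2)] by (simp add: scalar_prod_def lessThan_atLeast0)
  qed
  define R where "R j = looped_path_spectrum \<gamma> (of_rat (r j)) m" for j
  \<comment> \<open>Eigenvalues are indexed together with their block, so the spectra of different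
    blocks need not be shown to be disjoint.\<close>
  define I where "I = Sigma {..<n} R"
  have finI: "finite I"
    using card_looped_path_spectrum(2)[OF m] by (auto simp: I_def R_def)
  have root: "poly (looped_path_poly \<gamma> (of_rat (r j)) m) x = 0" if "(j, x) \<in> I" for j x
    using that by (simp add: I_def R_def looped_path_spectrum_def)
  \<comment> \<open>\<open>k'\<close> inverts \<open>k\<close> modulo \<open>n\<close>, so
    \<open>k' * E j\<close> is congruent to \<open>j\<close>.\<close>
  obtain k' y :: int where k': "k' * k + y * int n = 1"
    using bezout_int[of k "int n"] assms(7) by (auto simp: coprime_iff_gcd_eq_1)
  show ?thesis
    unfolding multiple_pretty_good_state_transfer_def pretty_good_state_transfer_def
  proof (intro allI impI ballI, elim conjE)
    fix h u v :: nat and \<epsilon> :: real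
    assume h: "1 \<le> h" "h \<le> m" and "u \<in> {rooted_vertex n a h |a. a < n}" "v \<in> {rooted_vertex n a h |a. a < n}"
      and \<epsilon>: "\<epsilon> > 0"
    then obtain a b where ab: "a < n" "b < n" and u: "u = rooted_vertex n a h" and v: "v = rooted_vertex n b h"
      by blast
    define s where "s = h - 1"
    have s: "s < m" using h by (simp add: s_def)
    have u: "u = s * n + a" and v: "v = s * n + b" using u v by (simp_all add: rooted_vertex_def s_def)
    have uv: "u < m * n" "v < m * n" using mult_add_less_mult[OF s] ab u v by auto
    define q where "q p x = poly (path_poly \<gamma> p) x" for p x
    \<comment> \<open>\<open>w i\<close> is the eigenvector of \<open>?Z\<close> indexed by
      \<open>i\<close>, and \<open>K i\<close> is the coefficient of the unit vector at
      \<open>v\<close> in this eigenbasis.\<close>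
    define w where "w i l = complex_of_real (q (l div n) (snd i)) * ?F (l mod n) (fst i)" for i l
    define K where "K i = complex_of_real (q s (snd i) / (\<Sum>p<m. (q p (snd i))\<^sup>2)) * cnj (?F b (fst i))" for i
    have expand: "(\<Sum>i\<in>I. K i * w i l) = of_bool (l = v)" if l: "l < m * n" for l
    proof -
      have ld: "l div n < m" "l mod n < n" using l n by (simp_all add: less_mult_imp_div_less)
      have "(\<Sum>i\<in>I. K i * w i l) =
          (\<Sum>j<n. \<Sum>x\<in>R j. of_real (q s x / (\<Sum>p<m. (q p x)\<^sup>2) * q (l div n) x) * (?F (l mod n) j * cnj (?F b j)))"
        unfolding I_def using card_looped_path_spectrum(2)[OF m]
        by (subst sum.Sigma) (auto simp: R_def K_def w_def mult_ac intro!: sum.cong)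
      also have "\<dots> = (\<Sum>j<n. of_bool (l div n = s) * (?F (l mod n) j * cnj (?F b j)))"
        unfolding sum_distrib_right[symmetric] of_real_sum[symmetric] R_def q_def
          looped_path_spectrum_completeness[OF m ld(1) s] by simp
      also have "\<dots> = of_bool (l div n = s) * of_bool (l mod n = b)"
        unfolding sum_distrib_left[symmetric] fourier_mat_rows_orthonormal[OF ld(2) ab(2)] ..
      also have "\<dots> = of_bool (l = v)"
        using v ab n by auto
      finally show ?thesis .
    qed
    have entry: "transition_mat ?Z t $$ (u, v) = (\<Sum>i\<in>I. K i * (exp (- \<i> * of_real t * of_real (snd i)) * w i u))" for t
    proof -
      have "transition_mat ?Z t $$ (u, v) = (\<Sum>l<m * n. transition_mat ?Z t $$ (u, l) * of_bool (l = v))"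
        using uv by simp
      also have "\<dots> = (\<Sum>l<m * n. \<Sum>i\<in>I. K i * (transition_mat ?Z t $$ (u, l) * w i l))"
        by (intro sum.cong refl) (simp add: expand[symmetric] sum_distrib_left sum_distrib_right mult_ac)
      also have "\<dots> = (\<Sum>i\<in>I. \<Sum>l<m * n. K i * (transition_mat ?Z t $$ (u, l) * w i l))"
        by (rule sum.swap)
      also have "\<dots> = (\<Sum>i\<in>I. K i * (exp (- \<i> * of_real t * of_real (snd i)) * w i u))"
      proof (rule sum.cong[OF refl])
        fix i assume i: "i \<in> I"
        obtain j x where jx: "i = (j, x)" by (cases i)
        have j: "j < n" using i by (simp add: I_def jx)
        have "(\<Sum>l<m * n. transition_mat ?Z t $$ (u, l) * w i l) = exp (- \<i> * of_real t * of_real x) * w i u"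
        proof (rule transition_mat_eigenvector[OF rooted_product_path_carrier[OF H] uv(1)])
          fix p assume "p < m * n"
          then show "(\<Sum>l<m * n. ?Z $$ (p, l) * w i l) = of_real x * w i p"
            using rooted_product_path_eigenvector[OF H m root, of j x "\<lambda>q. ?F q j" p] i eigX[OF _ j]
            by (simp add: w_def q_def jx)
        qed
        then show "(\<Sum>l<m * n. K i * (transition_mat ?Z t $$ (u, l) * w i l)) =
            K i * (exp (- \<i> * of_real t * of_real (snd i)) * w i u)"
          by (simp add: jx flip: sum_distrib_left)
      qed
      finally show ?thesis .
    qed
    have shift: "w i u = cis (2 * pi * ((real a - real b) * real (fst i) / real n)) * w i v" if "i \<in> I" for i
    proof -
      have "fst i < n" using that by (auto simp: I_def)
      then have "?F a (fst i) = cis (2 * pi * ((real a - real b) * real (fst i) / real n)) * ?F b (fst i)"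
        using ab by (simp add: index_fourier_mat cis_mult left_diff_distrib diff_divide_distrib algebra_simps)
      then show ?thesis using ab n by (simp add: w_def u v)
    qed
    \<comment> \<open>Modulo 1 this is the wanted phase (a - b) j / n. Choosing the multiple of
      \<open>E\<close> as representative makes integer relations among the eigenvalues pass to
      \<phi> exactly and not just modulo 1.\<close>
    define \<phi> where "\<phi> i = (real a - real b) * of_int (k' * E (fst i)) / real n" for i :: "nat \<times> real"
    have \<phi>: "\<exists>z::int. \<phi> i = (real a - real b) * real (fst i) / real n + of_int z" for i :: "nat \<times> real"
    proof -
      have "k' * E (fst i) = int (fst i) * (k' * k + y * int n) + int n * (k' * c' (fst i) - int (fst i) * y)"
        by (simp add: E_def algebra_simps)
      then have "k' * E (fst i) = int (fst i) + int n * (k' * c' (fst i) - int (fst i) * y)"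
        unfolding k' by simp
      then have eqE: "real_of_int (k' * E (fst i)) = real (fst i) + real n * of_int (k' * c' (fst i) - int (fst i) * y)"
        by (metis of_int_add of_int_mult of_int_of_nat_eq)
      have "\<phi> i = (real a - real b) * real (fst i) / real n +
          of_int ((int a - int b) * (k' * c' (fst i) - int (fst i) * y))"
        unfolding \<phi>_def eqE using n by (simp add: field_simps)
      then show ?thesis by blast
    qed
    have rel: "(\<Sum>i\<in>I. of_int (l i) * \<phi> i) = 0" if "(\<Sum>i\<in>I. of_int (l i) * snd i) = 0" for l :: "nat \<times> real \<Rightarrow> int"
    proof -
      have rt: "poly (looped_path_poly \<gamma> (of_rat (r (fst i))) m) (snd i) = 0" if "i \<in> I" for i
        using root[of "fst i" "snd i"] that by simp
      note L = root_relation[OF assms(10) m finI rt that]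
      have "(\<Sum>i\<in>I. real_of_int (l i) * of_rat (r (fst i))) = 0"
        using arg_cong[OF L(2), of "of_rat :: rat \<Rightarrow> real"] by (simp add: of_rat_sum of_rat_mult)
      moreover have "(\<Sum>i\<in>I. real_of_int (l i) * of_rat (r (fst i))) =
          (\<Sum>i\<in>I. \<alpha> * real_of_int (l i) + \<beta> * (real_of_int (l i) * of_int (E (fst i))))"
        by (intro sum.cong refl) (auto simp: I_def r_E algebra_simps)
      moreover have "\<dots> = \<alpha> * of_int (\<Sum>i\<in>I. l i) + \<beta> * (\<Sum>i\<in>I. real_of_int (l i) * of_int (E (fst i)))"
        by (simp add: sum.distrib sum_distrib_left)
      \<comment> \<open>The vanishing sum of the coefficients removes \<alpha>, and \<beta> can be
        cancelled.\<close>
      ultimately have "(\<Sum>i\<in>I. real_of_int (l i) * of_int (E (fst i))) = 0"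
        using L(1) assms(6) by simp
      moreover have "(\<Sum>i\<in>I. of_int (l i) * \<phi> i) =
          (real a - real b) * of_int k' / real n * (\<Sum>i\<in>I. real_of_int (l i) * of_int (E (fst i)))"
        by (simp add: \<phi>_def sum_distrib_left sum_divide_distrib mult_ac)
      ultimately show ?thesis by simp
    qed
    define M where "M = 1 + (\<Sum>i\<in>I. cmod (K i * w i v))"
    have M: "M > 0" unfolding M_def by (intro add_pos_nonneg sum_nonneg) auto
    \<comment> \<open>Each phase is then off by at most \<open>2 * pi * \<delta>\<close>, and
      weighting these errors by \<open>cmod (K i * w i v)\<close> keeps their total within
      \<epsilon>.\<close>
    define \<delta> where "\<delta> = \<epsilon> / (2 * pi * M)"
    have \<delta>: "\<delta> > 0" using \<epsilon> M by (simp add: \<delta>_def)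
    obtain \<tau> g where \<tau>: "\<And>i. i \<in> I \<Longrightarrow> \<bar>\<tau> * snd i - of_int (g i) - \<phi> i\<bar> < \<delta>"
      using kronecker_relations[OF finI \<delta>, of snd \<phi>] rel by blast
    let ?t = "2 * pi * \<tau>"
    define D where "D i = exp (- \<i> * of_real ?t * of_real (snd i)) *
        cis (2 * pi * ((real a - real b) * real (fst i) / real n))" for i :: "nat \<times> real"
    have D: "cmod (D i - 1) \<le> 2 * pi * \<delta>" if "i \<in> I" for i
    proof -
      obtain z :: int where z: "\<phi> i = (real a - real b) * real (fst i) / real n + of_int z" using \<phi> by blast
      let ?y = "\<tau> * snd i - of_int (g i) - \<phi> i"
      have e: "exp (- \<i> * of_real ?t * of_real (snd i)) = cis (- (?t * snd i))"
        by (simp add: cis_conv_exp mult_ac)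
      have "D i = cis (- (?t * snd i) + 2 * pi * (\<phi> i - of_int z))"
        unfolding D_def e cis_mult z by simp
      also have "- (?t * snd i) + 2 * pi * (\<phi> i - of_int z) = - (2 * pi * ?y) + 2 * pi * of_int (- g i - z)"
        by (simp add: algebra_simps)
      also have "cis \<dots> = cis (- (2 * pi * ?y))"
        unfolding cis_mult[symmetric] by (subst cis_multiple_2pi) simp_all
      finally have "cmod (D i - 1) \<le> \<bar>2 * pi * ?y\<bar>"
        using cmod_cis_minus_one_le[of "- (2 * pi * ?y)"] by simp
      also have "\<dots> \<le> 2 * pi * \<delta>" using \<tau>[OF that] by (simp add: abs_mult)
      finally show ?thesis .
    qed
    \<comment> \<open>The 1 is \<open>expand\<close> at the index \<open>v\<close> itself: with all
      phases \<open>D i\<close> equal to 1 the entry would be exactly 1.\<close>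
    have "transition_mat ?Z ?t $$ (u, v) - 1 = (\<Sum>i\<in>I. K i * w i v * D i) - (\<Sum>i\<in>I. K i * w i v)"
    proof -
      have "(\<Sum>i\<in>I. K i * (exp (- \<i> * of_real ?t * of_real (snd i)) * w i u)) = (\<Sum>i\<in>I. K i * w i v * D i)"
        by (intro sum.cong refl) (simp add: shift D_def mult_ac)
      then show ?thesis unfolding entry expand[OF uv(2)] by simp
    qed
    also have "\<dots> = (\<Sum>i\<in>I. K i * w i v * (D i - 1))"
      by (simp add: sum_subtractf right_diff_distrib)
    also have "cmod \<dots> \<le> (\<Sum>i\<in>I. cmod (K i * w i v) * (2 * pi * \<delta>))"
      using D by (intro sum_norm_le) (simp only: norm_mult mult_left_mono norm_ge_zero mult_nonneg_nonneg)
    also have "\<dots> = (\<Sum>i\<in>I. cmod (K i * w i v)) * (2 * pi * \<delta>)"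
      by (rule sum_distrib_right[symmetric])
    also have "\<dots> \<le> M * (2 * pi * \<delta>)"
      using \<delta> by (intro mult_right_mono) (simp_all add: M_def)
    also have "\<dots> = \<epsilon>" using M by (simp add: \<delta>_def)
    finally have "cmod (transition_mat ?Z ?t $$ (u, v) - 1) \<le> \<epsilon>" .
    then have "cmod (transition_mat ?Z ?t $$ (u, v)) \<ge> 1 - \<epsilon>"
      using norm_triangle_ineq2[of 1 "transition_mat ?Z ?t $$ (u, v)"] by (simp add: norm_minus_commute)
    then show "\<exists>\<tau>. 1 - \<epsilon> \<le> cmod (transition_mat ?Z \<tau> $$ (u, v))" by blast
  qed
qed

end
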